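(* Let $K$ satisfy both the kernel assumption (Existence) and the kernel assumption (Uniqueness) stated in the context. Let $\rho\ge0$ and $c_0\in\mathcal P_\rho$. Then weak solutions (in the sense defined in the context) of the continuous generalized exchange-driven growth equation having a Lebesgue density are unique for the given initial condition $c_0$: if $(c_t)_{t\ge0}$ and $(d_t)_{t\ge0}$ are two weak solutions with the same initial condition $c_0=d_0$ such that $c_t$ and $d_t$ have a Lebesgue density on $\mathbb R_+$ for almost all $t\ge0$, then $c_t=d_t$ for all $t\ge0$.
   Context: Notation. $\mathbb R_+=[0,\infty)$; $\mathcal P(\mathbb R_+)$ is the set of Borel probability measures on $\mathbb R_+$; $\mathcal P_\rho$ is the subset of measures with first moment equal to $\rho$. Kernel assumption (Existence). For all $z\ge0$, $K(\cdot,\cdot,z)\in C((0,\infty)\times\mathbb R_+;\mathbb R_+)$ and $K(x,y,z)\le C_K(1+x)(1+y)\varphi(z)$ for some constant $C_K$ and some $\varphi:\mathbb R_+\to\mathbb R_+$ such that $z\mapsto\varphi(z)$ and $z\mapsto z\varphi(z)$ are uniformly continuous and integrable. Moreover the functions $z\mapsto K(x,y,z)$, $x>0,y\ge0$, are uniformly continuous with a common modulus of continuity. Kernel assumption (Uniqueness). For all $z\ge0$, $K(\cdot,\cdot,z)\in C^2((0,\infty)\times\mathbb R_+;\mathbb R_+)$ satisfies, with the same $\varphi$, $$|\partial_1K(x,y,z)|\le(1+y)\varphi(z),\quad|\partial_2K(x,y,z)|\le(1+x)\varphi(z),\quad|\partial_1\partial_2K(x,y,z)|\le\varphi(z),$$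 and the boundary condition $K(x,y,x)=0$ for all $x,y\ge0$. Weak solution. A curve $c\in C([0,T];\mathcal P(\mathbb R_+))$ (for every $T>0$ when $c$ is defined on $[0,\infty)$) is a weak solution if for all Lipschitz $f:\mathbb R_+\to\mathbb R$ and all $0\le s\le t$, $$\int_0^\infty f(x)\,(c_t-c_s)(\mathrm dx)=\int_s^tQ(c_r)\cdot f\,\mathrm dr,\quad Q(c)\cdot f=\int_0^\infty\int_0^\infty\int_0^xK(x,y,z)\,\gamma^{x,y,z}\cdot f\,\mathrm dz\,c(\mathrm dy)\,c(\mathrm dx),$$ where $\gamma^{x,y,z}\cdot f=-f(x)-f(y)+f(x-z)+f(y+z)$. (Taking $f\equiv1$ and $f(x)=x$, weak solutions conserve total mass and first moment.) *)

theory Defs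
  imports "HOL-Probability.Probability"
begin

(* The half-line carries the measurable space restrict_space borel {0..}, whose carrier is {0..}:
   integrals against a member of prob_Rplus do not see the values of a total function on
   negative arguments. *)

definition prob_Rplus :: "real measure set" where
  "prob_Rplus = {M. prob_space M \<and> sets M = sets (restrict_space borel {0..})}"

definition prob_Rplus_moment :: "real \<Rightarrow> real measure set" where
  "prob_Rplus_moment \<rho> =
     {M \<in> prob_Rplus. integrable M (\<lambda>x. x) \<and> (LINT x|M. x) = \<rho>}"

definition has_lebesgue_density :: "real measure \<Rightarrow> bool" where
  "has_lebesgue_density M \<longleftrightarrow>
     (\<exists>g \<in> borel_measurable (restrict_space lborel {0..}).
        M = density (restrict_space lborel {0..}) g)"

(* Continuity of a curve with respect to the narrow topology of probability measures. *)
definition narrowly_continuous_on :: "real set \<Rightarrow> (real \<Rightarrow> real measure) \<Rightarrow> bool" where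
  "narrowly_continuous_on I c \<longleftrightarrow>
     (\<forall>f :: real \<Rightarrow> real. continuous_on {0..} f \<and> bounded (f ` {0..}) \<longrightarrow>
        continuous_on I (\<lambda>t. LINT x|c t. f x))"

definition lipschitz_Rplus :: "(real \<Rightarrow> real) \<Rightarrow> bool" where
  "lipschitz_Rplus f \<longleftrightarrow> (\<exists>L. L-lipschitz_on {0..} f)"


(* Kernels are total functions K x y z, but the regularity and growth assumptions constrain
   them only for x > 0, y \<ge> 0, z \<ge> 0. *)

abbreviation quadrant :: "(real \<times> real) set" where
  "quadrant \<equiv> {0<..} \<times> {0..}"

definition kernel_existence ::
    "(real \<Rightarrow> real \<Rightarrow> real \<Rightarrow> real) \<Rightarrow> real \<Rightarrow> (real \<Rightarrow> real) \<Rightarrow> bool" where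
  "kernel_existence K C\<^sub>K \<phi> \<longleftrightarrow>
     (\<forall>z\<ge>0. \<phi> z \<ge> 0) \<and>
     uniformly_continuous_on {0..} \<phi> \<and> set_integrable lborel {0..} \<phi> \<and>
     uniformly_continuous_on {0..} (\<lambda>z. z * \<phi> z) \<and>
     set_integrable lborel {0..} (\<lambda>z. z * \<phi> z) \<and>
     (\<forall>z\<ge>0. continuous_on quadrant (\<lambda>(x, y). K x y z)) \<and>
     (\<forall>x>0. \<forall>y\<ge>0. \<forall>z\<ge>0. 0 \<le> K x y z \<and> K x y z \<le> C\<^sub>K * (1 + x) * (1 + y) * \<phi> z) \<and>
     (\<exists>\<omega> :: real \<Rightarrow> real. (\<omega> \<longlongrightarrow> 0) (at_right 0) \<and>
        (\<forall>x>0. \<forall>y\<ge>0. \<forall>z\<ge>0. \<forall>z'\<ge>0. \<bar>K x y z - K x y z'\<bar> \<le> \<omega> \<bar>z - z'\<bar>))"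

(* Partial derivatives on the quadrant x > 0, y \<ge> 0; the derivative in y is one-sided at y = 0. *)

definition partial1 :: "(real \<Rightarrow> real \<Rightarrow> real) \<Rightarrow> real \<Rightarrow> real \<Rightarrow> real" where
  "partial1 F x y = vector_derivative (\<lambda>u. F u y) (at x within {0<..})"

definition partial2 :: "(real \<Rightarrow> real \<Rightarrow> real) \<Rightarrow> real \<Rightarrow> real \<Rightarrow> real" where
  "partial2 F x y = vector_derivative (\<lambda>v. F x v) (at y within {0..})"

definition C1_quadrant :: "(real \<Rightarrow> real \<Rightarrow> real) \<Rightarrow> bool" where
  "C1_quadrant F \<longleftrightarrow>
     continuous_on quadrant (\<lambda>(x, y). F x y) \<and>
     (\<forall>x>0. \<forall>y\<ge>0. (\<lambda>u. F u y) differentiable (at x within {0<..}) \<and>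
                   (\<lambda>v. F x v) differentiable (at y within {0..})) \<and>
     continuous_on quadrant (\<lambda>(x, y). partial1 F x y) \<and>
     continuous_on quadrant (\<lambda>(x, y). partial2 F x y)"

definition C2_quadrant :: "(real \<Rightarrow> real \<Rightarrow> real) \<Rightarrow> bool" where
  "C2_quadrant F \<longleftrightarrow>
     C1_quadrant F \<and> C1_quadrant (partial1 F) \<and> C1_quadrant (partial2 F)"

definition kernel_uniqueness ::
    "(real \<Rightarrow> real \<Rightarrow> real \<Rightarrow> real) \<Rightarrow> (real \<Rightarrow> real) \<Rightarrow> bool" where
  "kernel_uniqueness K \<phi> \<longleftrightarrow>
     (\<forall>z\<ge>0. C2_quadrant (\<lambda>x y. K x y z)) \<and>
     (\<forall>x>0. \<forall>y\<ge>0. \<forall>z\<ge>0.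
        0 \<le> K x y z \<and>
        \<bar>partial1 (\<lambda>x y. K x y z) x y\<bar> \<le> (1 + y) * \<phi> z \<and>
        \<bar>partial2 (\<lambda>x y. K x y z) x y\<bar> \<le> (1 + x) * \<phi> z \<and>
        \<bar>partial1 (partial2 (\<lambda>x y. K x y z)) x y\<bar> \<le> \<phi> z) \<and>
     (\<forall>x\<ge>0. \<forall>y\<ge>0. K x y x = 0)"


definition exchange :: "(real \<Rightarrow> real) \<Rightarrow> real \<Rightarrow> real \<Rightarrow> real \<Rightarrow> real" where
  "exchange f x y z = - f x - f y + f (x - z) + f (y + z)"

definition Q_op ::
    "(real \<Rightarrow> real \<Rightarrow> real \<Rightarrow> real) \<Rightarrow> real measure \<Rightarrow> (real \<Rightarrow> real) \<Rightarrow> real" where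
  "Q_op K M f =
     (LINT x|M. (LINT y|M. (LINT z:{0..x}|lborel. K x y z * exchange f x y z)))"

(* The integrability clauses say that both sides of the weak equation are meaningful (the
   Bochner integral of a non-integrable function is 0). For f x = x they give a finite first
   moment at every time; together with the bound in kernel_existence and
   \<bar>exchange f x y z\<bar> \<le> 2 * L * z for L-Lipschitz f, this makes the triple integral in Q_op
   absolutely convergent. *)
definition weak_solution ::
    "(real \<Rightarrow> real \<Rightarrow> real \<Rightarrow> real) \<Rightarrow> (real \<Rightarrow> real measure) \<Rightarrow> bool" where
  "weak_solution K c \<longleftrightarrow>
     (\<forall>t\<ge>0. c t \<in> prob_Rplus) \<and>
     (\<forall>T>0. narrowly_continuous_on {0..T} c) \<and>
     (\<forall>f. lipschitz_Rplus f \<longrightarrow>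
        (\<forall>t\<ge>0. integrable (c t) f) \<and>
        (\<forall>s t. 0 \<le> s \<and> s \<le> t \<longrightarrow>
           set_integrable lborel {s..t} (\<lambda>r. Q_op K (c r) f) \<and>
           (LINT x|c t. f x) - (LINT x|c s. f x) = (LINT r:{s..t}|lborel. Q_op K (c r) f)))"

end

theory Submission
  imports Defs
begin

text \<open>
  Let \<open>E t u\<close> be the difference at time \<open>t\<close> of the tails, that is of the masses which the two
  solutions give to \<open>(u, \<infinity>)\<close>. Its \<open>L\<^sup>1\<close> norm is the Wasserstein-1 distance of the two solutions; it
  is finite because the first moments are, and the proof is a Gronwall estimate for it.

  The norm is attained by testing with the function \<open>f\<close> whose slope is the sign of \<open>E t\<close>. To see how it
  evolves, write the difference of the quadratic collision terms as one factor \<open>c - d\<close> times one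
  factor \<open>c\<close> or \<open>d\<close>, and integrate by parts in the variable of \<open>c - d\<close>. The condition
  \<open>K x y x = 0\<close> removes the boundary term at \<open>z = x\<close>. When the derivative falls on \<open>K\<close>, the derivative
  bounds and \<open>\<bar>exchange f x y z\<bar> \<le> 2 * z\<close> leave a multiple of the norm of \<open>E\<close>. When it falls on
  \<open>f\<close>, the kernel grows linearly and its size is useless, but the sign helps: the term contains
  \<open>(f' (x - z) - f' x) * E x\<close>, which is nonpositive since \<open>f' x * E x = \<bar>E x\<bar>\<close> and \<open>\<bar>f'\<bar> \<le> 1\<close>
  (\<open>k_slope_dissipation_fst\<close> and \<open>k_slope_dissipation_snd\<close>).

  The test function has to be fixed during a time step, while \<open>E\<close> changes. This costs the kernel times
  the change of \<open>E\<close>, and the linear growth of the kernel would require second moments. Therefore the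
  slope is multiplied by \<open>weight R u = R / (R + u)\<close>. It makes kernel times slope bounded by a multiple of
  \<open>R\<close>, so that the cost of a step is quadratic in its length because the solutions are Lipschitz in time
  (\<open>tail_distance_time\<close>); the damage to the sign argument is bounded independently of \<open>R\<close>
  (\<open>weight_increment\<close>). Refining the partition and only then letting \<open>R\<close> tend to infinity yields a bound
  of the distance by a multiple of elapsed time times its supremum (\<open>distance_growth\<close>). Hence it
  vanishes on short intervals of uniform length, one after the other, and the tails determine the laws.
\<close>

section \<open>Integration on the line and indefinite integrals\<close>

lemma (in pair_sigma_finite) integrable_pair_times:
  fixes a b :: "_ \<Rightarrow> real"
  assumes "integrable M1 a" "integrable M2 b"
  shows "integrable (M1 \<Otimes>\<^sub>M M2) (\<lambda>(u, v). a u * b v)"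
proof -
  note [measurable] = borel_measurable_integrable[OF assms(1)] borel_measurable_integrable[OF assms(2)]
  show ?thesis
  proof (rule Fubini_integrable)
    show "integrable M1 (\<lambda>x. \<integral>y. norm (case (x, y) of (u, v) \<Rightarrow> a u * b v) \<partial>M2)"
      using assms by (simp add: abs_mult)
  qed (use assms in auto)
qed

text \<open>The factors are only indefinite integrals of integrable functions, since the slopes used later
  jump at every sign change, so no pointwise derivative is at hand. The product of the two increments
  is an integral of \<open>a u * b v\<close> over a square; cutting the square along its diagonal and
  integrating each triangle in the convenient order gives the two terms.\<close>
lemma integral_product_rule:
  fixes a b A B :: "real \<Rightarrow> real"
  assumes st: "s \<le> t"
    and a: "set_integrable lborel {s..t} a" and b: "set_integrable lborel {s..t} b"
    and A: "\<And>x. x \<in> {s..t} \<Longrightarrow> A x = A s + (LINT u:{s..x}|lborel. a u)"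
    and B: "\<And>x. x \<in> {s..t} \<Longrightarrow> B x = B s + (LINT u:{s..x}|lborel. b u)"
  shows "A t * B t - A s * B s = (LINT u:{s..t}|lborel. a u * B u + A u * b u)"
proof -
  define a' where "a' u = indicator {s..t} u * a u" for u
  define b' where "b' u = indicator {s..t} u * b u" for u
  have a': "integrable lborel a'" and b': "integrable lborel b'"
    using a b by (simp_all add: set_integrable_def a'_def[abs_def] b'_def[abs_def])
  note [measurable] = borel_measurable_integrable[OF a'] borel_measurable_integrable[OF b']
  have ab: "integrable (lborel \<Otimes>\<^sub>M lborel) (\<lambda>(u, v). a' u * b' v)"
    by (rule lborel_pair.integrable_pair_times[OF a' b'])
  have lo: "integrable (lborel \<Otimes>\<^sub>M lborel) (\<lambda>(u, v). (if v \<le> u then a' u * b' v else 0))"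
    by (rule Bochner_Integration.integrable_bound[OF ab])
       (auto simp: indicator_def split: prod.splits)
  have up: "integrable (lborel \<Otimes>\<^sub>M lborel) (\<lambda>(u, v). (if u < v then a' u * b' v else 0))"
    by (rule Bochner_Integration.integrable_bound[OF ab])
       (auto simp: indicator_def split: prod.splits)
  have B': "(\<integral>v. (if v \<le> u then a' u * b' v else 0) \<partial>lborel) = a' u * (B u - B s)" for u
  proof (cases "u \<in> {s..t}")
    case True
    then have "(\<lambda>v. b' v * indicator {..u} v) = (\<lambda>v. indicator {s..u} v *\<^sub>R b v)"
      by (auto simp: b'_def indicator_def fun_eq_iff)
    then have "(\<integral>v. b' v * indicator {..u} v \<partial>lborel) = B u - B s"
      using B[OF True] by (simp add: set_lebesgue_integral_def)
    moreover have "(\<integral>v. (if v \<le> u then a' u * b' v else 0) \<partial>lborel)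
        = (\<integral>v. a' u * (b' v * indicator {..u} v) \<partial>lborel)"
      by (rule Bochner_Integration.integral_cong) (auto simp: indicator_def)
    ultimately show ?thesis by simp
  qed (simp add: a'_def cong: if_cong)
  have A': "(\<integral>u. (if u < v then a' u * b' v else 0) \<partial>lborel) = b' v * (A v - A s)" for v
  proof (cases "v \<in> {s..t}")
    case True
    have "(\<integral>u. (if u < v then a' u else 0) \<partial>lborel) = (\<integral>u. indicator {s..v} u *\<^sub>R a u \<partial>lborel)"
    proof (rule integral_cong_AE)
      show "AE u in lborel. (if u < v then a' u else 0) = indicator {s..v} u *\<^sub>R a u"
        by (rule eventually_mono[OF AE_lborel_singleton[of v]])
           (use True in \<open>auto simp: a'_def indicator_def\<close>)
      have "(\<lambda>u. indicator {s..v} u *\<^sub>R a u) = (\<lambda>u. indicator {..v} u * a' u)"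
        using True by (auto simp: a'_def indicator_def fun_eq_iff)
      then show "(\<lambda>u. indicator {s..v} u *\<^sub>R a u) \<in> borel_measurable lborel" by simp
    qed simp
    then have "(\<integral>u. (if u < v then a' u else 0) \<partial>lborel) = A v - A s"
      using A[OF True] by (simp add: set_lebesgue_integral_def)
    moreover have "(\<integral>u. (if u < v then a' u * b' v else 0) \<partial>lborel)
        = b' v * (\<integral>u. (if u < v then a' u else 0) \<partial>lborel)"
      by (subst integral_mult_right_zero[symmetric])
         (rule Bochner_Integration.integral_cong, auto)
    ultimately show ?thesis by simp
  qed (simp add: b'_def cong: if_cong)
  have int1: "integrable lborel (\<lambda>u. a' u * (B u - B s))"
    using lborel_pair.integrable_fst'[OF lo] by (simp add: B')
  have int2: "integrable lborel (\<lambda>v. b' v * (A v - A s))"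
    using lborel_pair.integrable_snd[OF up] by (simp add: A')
  have At: "(\<integral>u. a' u \<partial>lborel) = A t - A s" and Bt: "(\<integral>u. b' u \<partial>lborel) = B t - B s"
    using A[of t] B[of t] st by (simp_all add: set_lebesgue_integral_def a'_def b'_def)
  have "(\<integral>u. a' u * (B u - B s) \<partial>lborel) + (\<integral>v. b' v * (A v - A s) \<partial>lborel)
      = (\<integral>u. (\<integral>v. (if v \<le> u then a' u * b' v else 0) \<partial>lborel) \<partial>lborel)
        + (\<integral>u. (\<integral>v. (if u < v then a' u * b' v else 0) \<partial>lborel) \<partial>lborel)"
    unfolding lborel_pair.Fubini_integral[OF up, symmetric] B' A' ..
  also have "\<dots> = (\<integral>z. (case z of (u, v) \<Rightarrow> (if v \<le> u then a' u * b' v else 0))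
        + (case z of (u, v) \<Rightarrow> (if u < v then a' u * b' v else 0)) \<partial>(lborel \<Otimes>\<^sub>M lborel))"
    using lo up lborel_pair.integral_fst'[OF lo] lborel_pair.integral_fst'[OF up] by simp
  also have "\<dots> = (\<integral>z. (case z of (u, v) \<Rightarrow> a' u * b' v) \<partial>(lborel \<Otimes>\<^sub>M lborel))"
    by (rule Bochner_Integration.integral_cong) (auto simp: indicator_def)
  also have "\<dots> = (\<integral>u. a' u \<partial>lborel) * (\<integral>v. b' v \<partial>lborel)"
    using lborel_pair.integral_fst'[OF ab] by simp
  also have "\<dots> = (A t - A s) * (B t - B s)"
    by (simp add: At Bt)
  finally have main: "(\<integral>u. a' u * (B u - B s) \<partial>lborel) + (\<integral>v. b' v * (A v - A s) \<partial>lborel)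
      = (A t - A s) * (B t - B s)" .
  have "(LINT u:{s..t}|lborel. a u * B u + A u * b u)
      = (\<integral>u. (a' u * (B u - B s) + b' u * (A u - A s)) + (B s * a' u + A s * b' u) \<partial>lborel)"
    unfolding set_lebesgue_integral_def
    by (rule Bochner_Integration.integral_cong)
       (auto simp: a'_def b'_def indicator_def algebra_simps)
  also have "\<dots> = (A t - A s) * (B t - B s) + (B s * (A t - A s) + A s * (B t - B s))"
    using int1 int2 a' b' main by (simp add: At Bt)
  finally show ?thesis by (simp add: algebra_simps)
qed

lemma dominated_integral:
  fixes f g :: "'a \<Rightarrow> real"
  assumes "f \<in> borel_measurable M" "integrable M g" "\<And>x. x \<in> space M \<Longrightarrow> \<bar>f x\<bar> \<le> g x"
  shows "integrable M f" "\<bar>\<integral>x. f x \<partial>M\<bar> \<le> (\<integral>x. g x \<partial>M)"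
proof -
  show i: "integrable M f"
    by (rule Bochner_Integration.integrable_bound[OF assms(2,1)])
       (use assms(3) in \<open>auto intro: order_trans[OF _ abs_ge_self]\<close>)
  have "\<bar>\<integral>x. f x \<partial>M\<bar> \<le> (\<integral>x. \<bar>f x\<bar> \<partial>M)"
    by (rule integral_abs_bound)
  also have "\<dots> \<le> (\<integral>x. g x \<partial>M)"
    by (rule integral_mono) (use i assms in auto)
  finally show "\<bar>\<integral>x. f x \<partial>M\<bar> \<le> (\<integral>x. g x \<partial>M)" .
qed

lemma bounded_set_integrable:
  fixes p :: "real \<Rightarrow> real"
  assumes [measurable]: "p \<in> borel_measurable borel" and "\<And>u. u \<in> {a..b} \<Longrightarrow> \<bar>p u\<bar> \<le> m"
  shows "set_integrable lborel {a..b} p"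
  unfolding set_integrable_def
proof (rule Bochner_Integration.integrable_bound)
  show "integrable lborel (\<lambda>u. m * indicator {a..b} u)"
    by (cases "a \<le> b") auto
  show "AE u in lborel. norm (indicator {a..b} u *\<^sub>R p u) \<le> norm (m * indicator {a..b} u)"
    using assms(2) by (intro AE_I2) (force simp: indicator_def)
qed simp

lemma set_integral_shift:
  fixes p :: "real \<Rightarrow> real"
  shows "(LINT v:{a..b}|lborel. p (v + c)) = (LINT v:{a + c..b + c}|lborel. p v)"
proof -
  have "(\<integral>v. indicator {a + c..b + c} v *\<^sub>R p v \<partial>lborel)
      = (\<integral>v. indicator {a + c..b + c} (c + 1 * v) *\<^sub>R p (c + 1 * v) \<partial>lborel)"
    by (subst lborel_integral_real_affine[where c=1 and t=c]) simp_all
  also have "\<dots> = (\<integral>v. indicator {a..b} v *\<^sub>R p (v + c) \<partial>lborel)"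
    by (rule Bochner_Integration.integral_cong) (auto simp: indicator_def add.commute)
  finally show ?thesis by (simp add: set_lebesgue_integral_def)
qed

lemma set_integral_split:
  fixes p :: "real \<Rightarrow> real"
  assumes "set_integrable lborel {a..c} p" "a \<le> b" "b \<le> c"
  shows "(LINT u:{a..c}|lborel. p u) = (LINT u:{a..b}|lborel. p u) + (LINT u:{b..c}|lborel. p u)"
proof -
  have 1: "set_integrable lborel {a..b} p" and 2: "set_integrable lborel {b..c} p"
    by (rule set_integrable_subset[OF assms(1)]; use assms(2,3) in auto)+
  have "(LINT u:{a..b} \<union> {b..c}|lborel. p u) = (LINT u:{a..b}|lborel. p u) + (LINT u:{b..c}|lborel. p u)"
  proof (rule set_integral_Un_AE[OF _ _ _ 1 2])
    show "AE x in lborel. \<not> (x \<in> {a..b} \<and> x \<in> {b..c})"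
      by (rule eventually_mono[OF AE_lborel_singleton[of b]]) auto
  qed auto
  moreover have "{a..b} \<union> {b..c} = {a..c}" using assms(2,3) by auto
  ultimately show ?thesis by simp
qed

text \<open>The form of Fubini needed below: an integral over the transferred amount \<open>z\<close> is
  exchanged with one over a bounded range of sizes, under a bound depending on \<open>z\<close> alone.\<close>
lemma set_integral_swap:
  fixes H :: "real \<Rightarrow> real \<Rightarrow> real"
  assumes [measurable]: "(\<lambda>(u, z). H u z) \<in> borel_measurable (borel \<Otimes>\<^sub>M borel)"
    and g: "integrable lborel g" and bd: "\<And>u z. u \<in> {0..b} \<Longrightarrow> \<bar>H u z\<bar> \<le> g z"
  shows "integrable lborel (\<lambda>z. LINT u:{0..b}|lborel. H u z)"
    "(\<integral>z. (LINT u:{0..b}|lborel. H u z) \<partial>lborel) = (LINT u:{0..b}|lborel. (\<integral>z. H u z \<partial>lborel))"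
proof -
  have ib: "integrable lborel (indicator {0..b} :: real \<Rightarrow> real)"
    by (cases "0 \<le> b") auto
  have "integrable (lborel \<Otimes>\<^sub>M lborel) (\<lambda>(u, z). indicator {0..b} u * H u z)"
  proof (rule Bochner_Integration.integrable_bound[OF lborel_pair.integrable_pair_times[OF ib g]])
    have "(\<lambda>(u, z). if 0 \<le> u \<and> u \<le> b then H u z else 0) \<in> borel_measurable (lborel \<Otimes>\<^sub>M lborel)"
      by measurable
    also have "(\<lambda>(u, z). if 0 \<le> u \<and> u \<le> b then H u z else 0) = (\<lambda>(u, z). indicator {0..b} u * H u z)"
      by auto
    finally show "(\<lambda>(u, z). indicator {0..b} u * H u z) \<in> borel_measurable (lborel \<Otimes>\<^sub>M lborel)" .
    show "AE x in lborel \<Otimes>\<^sub>M lborel. norm (case x of (u, z) \<Rightarrow> indicator {0..b} u * H u z)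
        \<le> norm (case x of (u, z) \<Rightarrow> indicator {0..b} u * g z)"
      using bd by (intro AE_I2) (auto split: split_indicator intro: order_trans[OF _ abs_ge_self])
  qed
  note I = this
  show "integrable lborel (\<lambda>z. LINT u:{0..b}|lborel. H u z)"
    using lborel_pair.integrable_snd[OF I] by (simp add: set_lebesgue_integral_def)
  show "(\<integral>z. (LINT u:{0..b}|lborel. H u z) \<partial>lborel) = (LINT u:{0..b}|lborel. (\<integral>z. H u z \<partial>lborel))"
    using lborel_pair.Fubini_integral[OF I] by (simp add: set_lebesgue_integral_def)
qed

lemma set_integral_le_const:
  fixes g :: "real \<Rightarrow> real"
  assumes "s \<le> t" "set_integrable lborel {s..t} g" "\<And>r. r \<in> {s..t} \<Longrightarrow> g r \<le> c"
  shows "(LINT r:{s..t}|lborel. g r) \<le> (t - s) * c"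
proof -
  have "(LINT r:{s..t}|lborel. g r) \<le> (LINT r:{s..t}|lborel. c)"
    by (rule set_integral_mono) (use assms in \<open>auto simp: set_integrable_def\<close>)
  also have "\<dots> = (t - s) * c"
    using assms(1) by (simp add: set_lebesgue_integral_def)
  finally show ?thesis .
qed

definition antideriv :: "(real \<Rightarrow> real) \<Rightarrow> real \<Rightarrow> real" where
  "antideriv p x = (LINT u:{0..x}|lborel. p u)"

text \<open>Test functions are handled through their slopes: every \<open>antideriv p\<close> below is Lipschitz with
  constant 1 on the half-line, and \<open>p\<close> may be as irregular as a sign function.\<close>
locale test_slope =
  fixes p :: "real \<Rightarrow> real"
  assumes slope_measurable [measurable]: "p \<in> borel_measurable borel"
    and slope_le_1: "\<bar>p u\<bar> \<le> 1"
begin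

lemma slope_set_integrable: "set_integrable lborel {a..b} p"
  by (rule bounded_set_integrable[where m=1]) (auto simp: slope_le_1)

lemma slope_shift_set_integrable: "set_integrable lborel {a..b} (\<lambda>v. p (v + c))"
  by (rule bounded_set_integrable[where m=1]) (auto simp: slope_le_1)

lemma antideriv_add: "0 \<le> a \<Longrightarrow> a \<le> b \<Longrightarrow> antideriv p b = antideriv p a + (LINT u:{a..b}|lborel. p u)"
  unfolding antideriv_def by (rule set_integral_split[OF slope_set_integrable])

lemma antideriv_lipschitz_le: "0 \<le> a \<Longrightarrow> a \<le> b \<Longrightarrow> \<bar>antideriv p b - antideriv p a\<bar> \<le> b - a"
proof -
  assume ab: "0 \<le> a" "a \<le> b"
  have "\<bar>LINT u:{a..b}|lborel. p u\<bar> \<le> (\<integral>u. indicator {a..b} u \<partial>lborel)"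
    unfolding set_lebesgue_integral_def
    by (rule dominated_integral) (use slope_le_1 ab in \<open>auto split: split_indicator\<close>)
  then show ?thesis using antideriv_add[OF ab] ab by simp
qed

lemma antideriv_lipschitz: "0 \<le> a \<Longrightarrow> 0 \<le> b \<Longrightarrow> \<bar>antideriv p b - antideriv p a\<bar> \<le> \<bar>b - a\<bar>"
  using antideriv_lipschitz_le[of a b] antideriv_lipschitz_le[of b a] by linarith

lemma lipschitz_antideriv: "lipschitz_Rplus (antideriv p)"
  unfolding lipschitz_Rplus_def
  by (rule exI[of _ 1], rule lipschitz_onI)
     (auto simp: dist_real_def antideriv_lipschitz)

lemma antideriv_measurable [measurable]: "antideriv p \<in> borel_measurable borel"
proof -
  have "(\<lambda>(x, u). if 0 \<le> u \<and> u \<le> x then p u else 0) \<in> borel_measurable (borel \<Otimes>\<^sub>M lborel)"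
    by measurable
  then have "(\<lambda>x. \<integral>u. (if 0 \<le> u \<and> u \<le> x then p u else 0) \<partial>lborel) \<in> borel_measurable borel"
    by (rule lborel.borel_measurable_lebesgue_integral)
  also have "(\<lambda>x. \<integral>u. (if 0 \<le> u \<and> u \<le> x then p u else 0) \<partial>lborel) = antideriv p"
    unfolding antideriv_def[abs_def] set_lebesgue_integral_def
    by (intro ext Bochner_Integration.integral_cong) auto
  finally show ?thesis .
qed

lemma antideriv_0: "antideriv p 0 = 0"
  unfolding antideriv_def set_lebesgue_integral_def
  by (rule integral_eq_zero_AE, rule eventually_mono[OF AE_lborel_singleton[of 0]]) auto

abbreviation f where "f \<equiv> antideriv p"

lemma exchange_bound:
  assumes "0 \<le> z" "z \<le> x" "0 \<le> y"
  shows "\<bar>exchange f x y z\<bar> \<le> 2 * z"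
  using antideriv_lipschitz_le[of "x - z" x] antideriv_lipschitz_le[of y "y + z"] assms
  by (simp add: exchange_def)

text \<open>As a function of the donor size \<open>u\<close>, an exchange is again an indefinite integral; this and
  the next lemma provide one factor for the product rule.\<close>
lemma exchange_fst:
  assumes "0 \<le> z" "z \<le> u"
  shows "exchange f u y z = exchange f z y z + (LINT v:{z..u}|lborel. p (v - z) - p v)"
proof -
  have 1: "f u = f z + (LINT v:{z..u}|lborel. p v)"
    by (rule antideriv_add) (use assms in auto)
  have 2: "f (u - z) = f 0 + (LINT v:{z..u}|lborel. p (v - z))"
    using antideriv_add[of 0 "u - z"] set_integral_shift[of z u p "- z"] assms by simp
  have 3: "set_integrable lborel {z..u} (\<lambda>v. p (v - z))"
    using slope_shift_set_integrable[of z u "- z"] by simp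
  show ?thesis
    using 1 2 by (simp add: exchange_def set_integral_diff[OF 3 slope_set_integrable])
qed

lemma exchange_snd:
  assumes "0 \<le> z" "0 \<le> y"
  shows "exchange f x y z = exchange f x 0 z + (LINT v:{0..y}|lborel. p (v + z) - p v)"
proof -
  have 1: "f y = f 0 + (LINT v:{0..y}|lborel. p v)"
    by (rule antideriv_add) (use assms in auto)
  have 2: "f (y + z) = f z + (LINT v:{0..y}|lborel. p (v + z))"
    using antideriv_add[of z "y + z"] set_integral_shift[of 0 y p z] assms by simp
  show ?thesis
    using 1 2 by (simp add: exchange_def set_integral_diff[OF slope_shift_set_integrable slope_set_integrable])
qed

lemma exchange_measurable [measurable]:
  assumes [measurable]: "g \<in> borel_measurable M" "h \<in> borel_measurable M" "i \<in> borel_measurable M"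
  shows "(\<lambda>w. exchange f (g w) (h w) (i w)) \<in> borel_measurable M"
  unfolding exchange_def by measurable

end

section \<open>Laws on the half-line and integration by parts against their tails\<close>

locale halfline_law = real_distribution M for M :: "real measure" +
  assumes nonneg: "AE x in M. 0 \<le> x"
    and first_moment: "integrable M (\<lambda>x. x)"

text \<open>The value 0 on negative arguments lets integrals against tails run over the whole line.\<close>
definition tail :: "real measure \<Rightarrow> real \<Rightarrow> real" where
  "tail M u = indicator {0..} u * measure M {u<..}"

context halfline_law begin

lemma borel_measurable_tail [measurable]: "tail M \<in> borel_measurable borel"
proof -
  have "mono (\<lambda>u. - measure M {u<..})"
    by (intro monoI) (auto intro!: finite_measure_mono)
  then have "(\<lambda>u. - measure M {u<..}) \<in> borel_measurable borel"
    by (rule borel_measurable_mono)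
  then have "(\<lambda>u. - (- measure M {u<..})) \<in> borel_measurable borel"
    by (rule borel_measurable_uminus)
  then show ?thesis by (simp add: tail_def[abs_def])
qed

lemma tail_nonneg: "0 \<le> tail M u"
  by (simp add: tail_def)

text \<open>Fubini on the region \<open>0 \<le> u < x\<close>. A law with a first moment has an integrable tail, so a
  bounded derivative \<open>q\<close> suffices for absolute convergence.\<close>
lemma tail_by_parts:
  fixes q g :: "real \<Rightarrow> real"
  assumes q[measurable]: "q \<in> borel_measurable borel" and bd: "\<And>u. 0 \<le> u \<Longrightarrow> \<bar>q u\<bar> \<le> b"
    and g[measurable]: "g \<in> borel_measurable borel"
    and eq: "\<And>x. 0 \<le> x \<Longrightarrow> g x = g 0 + (LINT u:{0..x}|lborel. q u)"
  shows "integrable M g" "integrable lborel (\<lambda>u. q u * tail M u)"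
    "(\<integral>x. g x \<partial>M) = g 0 + (\<integral>u. q u * tail M u \<partial>lborel)"
proof -
  interpret P: pair_sigma_finite M lborel ..
  define F where "F x u = indicator {0..<x} u * q u" for x u :: real
  have b0: "0 \<le> b" using bd[of 0] by simp
  have Fm[measurable]: "F x \<in> borel_measurable borel" for x
    unfolding F_def[abs_def] by simp
  have F_int: "integrable lborel (F x)" and F_le: "(\<integral>u. norm (F x u) \<partial>lborel) \<le> b * \<bar>x\<bar>" for x
  proof -
    have bi: "integrable lborel (\<lambda>u. b * indicator {0..<x} u)"
      by (cases "0 \<le> x") (auto intro!: integrable_mult_right integrable_real_indicator)
    show i: "integrable lborel (F x)"
      by (rule Bochner_Integration.integrable_bound[OF bi])
         (use bd b0 in \<open>auto simp: F_def abs_mult indicator_def\<close>)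
    have "(\<integral>u. norm (F x u) \<partial>lborel) \<le> (\<integral>u. b * indicator {0..<x} u \<partial>lborel)"
      using bd b0 by (intro integral_mono bi integrable_norm i) (auto simp: F_def indicator_def)
    also have "\<dots> \<le> b * \<bar>x\<bar>"
      using b0 by (cases "0 \<le> x") (auto simp: mult_nonneg_nonpos)
    finally show "(\<integral>u. norm (F x u) \<partial>lborel) \<le> b * \<bar>x\<bar>" .
  qed
  have meas[measurable]: "(\<lambda>(x, u). F x u) \<in> borel_measurable (M \<Otimes>\<^sub>M lborel)"
  proof -
    have "(\<lambda>(x, u). if 0 \<le> u \<and> u < x then q u else 0) \<in> borel_measurable (M \<Otimes>\<^sub>M lborel)"
      by measurable
    also have "(\<lambda>(x, u). if 0 \<le> u \<and> u < x then q u else 0) = (\<lambda>(x, u). F x u)"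
      by (auto simp: F_def)
    finally show ?thesis .
  qed
  have PI: "integrable (M \<Otimes>\<^sub>M lborel) (\<lambda>(x, u). F x u)"
  proof (rule P.Fubini_integrable)
    have "integrable M (\<lambda>x. b * \<bar>x\<bar>)" using first_moment by simp
    then show "integrable M (\<lambda>x. \<integral>u. norm (case (x, u) of (x, u) \<Rightarrow> F x u) \<partial>lborel)"
    proof (rule Bochner_Integration.integrable_bound)
      show "(\<lambda>x. \<integral>u. norm (case (x, u) of (x, u) \<Rightarrow> F x u) \<partial>lborel) \<in> borel_measurable M"
        by measurable
      have "0 \<le> (\<integral>u. norm (F x u) \<partial>lborel)" for x by simp
      then show "AE x in M. norm (\<integral>u. norm (case (x, u) of (x, u) \<Rightarrow> F x u) \<partial>lborel) \<le> norm (b * \<bar>x\<bar>)"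
        using F_le b0 by (intro AE_I2) (simp only: prod.case real_norm_def abs_mult abs_abs abs_of_nonneg)
    qed
  qed (use F_int in auto)
  have gF: "AE x in M. g x = g 0 + (\<integral>u. F x u \<partial>lborel)"
    using nonneg
  proof eventually_elim
    case (elim x)
    have "(\<integral>u. F x u \<partial>lborel) = (LINT u:{0..x}|lborel. q u)"
      unfolding set_lebesgue_integral_def
    proof (rule integral_cong_AE)
      show "AE u in lborel. F x u = indicator {0..x} u *\<^sub>R q u"
        by (rule eventually_mono[OF AE_lborel_singleton[of x]]) (auto simp: F_def indicator_def)
    qed auto
    then show ?case using eq[OF elim] by simp
  qed
  have iF: "integrable M (\<lambda>x. \<integral>u. F x u \<partial>lborel)"
    using P.integrable_fst'[OF PI] by simp
  show "integrable M g"
    by (rule integrable_cong_AE_imp[where g="\<lambda>x. g 0 + (\<integral>u. F x u \<partial>lborel)"])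
       (use iF gF in \<open>auto elim: eventually_mono\<close>)
  have Fx: "(\<integral>x. F x u \<partial>M) = q u * tail M u" for u
  proof -
    have "(\<integral>x. F x u \<partial>M) = (\<integral>x. (q u * indicator {0..} u) * indicator {u<..} x \<partial>M)"
      by (rule Bochner_Integration.integral_cong) (auto simp: F_def indicator_def)
    then show ?thesis by (simp add: tail_def)
  qed
  show "integrable lborel (\<lambda>u. q u * tail M u)"
    using P.integrable_snd[OF PI] by (simp add: Fx)
  have "(\<integral>x. g x \<partial>M) = (\<integral>x. g 0 + (\<integral>u. F x u \<partial>lborel) \<partial>M)"
    by (rule integral_cong_AE) (use gF iF in auto)
  also have "\<dots> = g 0 + (\<integral>x. (\<integral>u. F x u \<partial>lborel) \<partial>M)"
    using iF prob_space by simp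
  also have "(\<integral>x. (\<integral>u. F x u \<partial>lborel) \<partial>M) = (\<integral>u. (\<integral>x. F x u \<partial>M) \<partial>lborel)"
    by (rule P.Fubini_integral[OF PI, symmetric])
  finally show "(\<integral>x. g x \<partial>M) = g 0 + (\<integral>u. q u * tail M u \<partial>lborel)"
    by (simp add: Fx)
qed

lemma tail_integrable: "integrable lborel (tail M)"
  and integral_tail: "(\<integral>u. tail M u \<partial>lborel) = (\<integral>x. x \<partial>M)"
proof -
  have eq: "x = 0 + (LINT u:{0..x}|lborel. 1)" if "0 \<le> x" for x :: real
    using that by (simp add: set_lebesgue_integral_def)
  have "(\<lambda>_::real. 1::real) \<in> borel_measurable borel" "\<bar>1::real\<bar> \<le> 1"
    "(\<lambda>x::real. x) \<in> borel_measurable borel" by simp_all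
  note parts = tail_by_parts[OF this(1) this(2) this(3) eq]
  from parts(2) show "integrable lborel (tail M)" by simp
  from parts(3) show "(\<integral>u. tail M u \<partial>lborel) = (\<integral>x. x \<partial>M)" by simp
qed

end

section \<open>The rate at which exchanges change a test function\<close>

text \<open>An abstract kernel together with its two partial derivatives, in integrated form. All three
  vanish unless \<open>0 < z \<le> x\<close> and \<open>0 \<le> y\<close>, so that integrals over \<open>z\<close> can run over the whole line.
  That \<open>k_fst\<close> has no initial term at \<open>u = z\<close> is the boundary condition \<open>K z y z = 0\<close>: without
  it, differentiating the integral over \<open>z \<le> x\<close> in \<open>x\<close> would produce a boundary term.\<close>
locale exchange_kernel =
  fixes k k1 k2 :: "real \<Rightarrow> real \<Rightarrow> real \<Rightarrow> real" and \<phi> :: "real \<Rightarrow> real" and C :: real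
  assumes k_meas: "(\<lambda>(x, y, z). k x y z) \<in> borel_measurable (borel \<Otimes>\<^sub>M borel \<Otimes>\<^sub>M borel)"
    and k1_meas: "(\<lambda>(x, y, z). k1 x y z) \<in> borel_measurable (borel \<Otimes>\<^sub>M borel \<Otimes>\<^sub>M borel)"
    and k2_meas: "(\<lambda>(x, y, z). k2 x y z) \<in> borel_measurable (borel \<Otimes>\<^sub>M borel \<Otimes>\<^sub>M borel)"
    and C_nonneg: "0 \<le> C"
    and phi_nonneg: "0 \<le> \<phi> z"
    and phi_integrable: "integrable lborel \<phi>"
    and zphi_integrable: "integrable lborel (\<lambda>z. z * \<phi> z)"
    and phi_supp: "z < 0 \<Longrightarrow> \<phi> z = 0"
    and k_nonneg: "0 \<le> k x y z"
    and k_le: "0 \<le> x \<Longrightarrow> 0 \<le> y \<Longrightarrow> k x y z \<le> C * (1 + x) * (1 + y) * \<phi> z"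
    and k1_le: "0 \<le> x \<Longrightarrow> 0 \<le> y \<Longrightarrow> \<bar>k1 x y z\<bar> \<le> (1 + y) * \<phi> z"
    and k2_le: "0 \<le> x \<Longrightarrow> 0 \<le> y \<Longrightarrow> \<bar>k2 x y z\<bar> \<le> (1 + x) * \<phi> z"
    and k_supp: "\<not> (0 < z \<and> z \<le> x \<and> 0 \<le> y) \<Longrightarrow> k x y z = 0"
    and k1_supp: "\<not> (0 < z \<and> z \<le> x \<and> 0 \<le> y) \<Longrightarrow> k1 x y z = 0"
    and k2_supp: "\<not> (0 < z \<and> z \<le> x \<and> 0 \<le> y) \<Longrightarrow> k2 x y z = 0"
    and k_fst: "0 < z \<Longrightarrow> z \<le> x \<Longrightarrow> 0 \<le> y \<Longrightarrow> k x y z = (LINT u:{z..x}|lborel. k1 u y z)"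
    and k_snd: "0 < z \<Longrightarrow> z \<le> x \<Longrightarrow> 0 \<le> y \<Longrightarrow> k x y z = k x 0 z + (LINT v:{0..y}|lborel. k2 x v z)"
begin

lemma k_measurable [measurable]:
  assumes [measurable]: "g \<in> borel_measurable M" "h \<in> borel_measurable M" "i \<in> borel_measurable M"
  shows "(\<lambda>w. k (g w) (h w) (i w)) \<in> borel_measurable M"
    "(\<lambda>w. k1 (g w) (h w) (i w)) \<in> borel_measurable M"
    "(\<lambda>w. k2 (g w) (h w) (i w)) \<in> borel_measurable M"
proof -
  have t: "(\<lambda>w. (g w, h w, i w)) \<in> M \<rightarrow>\<^sub>M borel \<Otimes>\<^sub>M borel \<Otimes>\<^sub>M borel" by measurable
  show "(\<lambda>w. k (g w) (h w) (i w)) \<in> borel_measurable M"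
    "(\<lambda>w. k1 (g w) (h w) (i w)) \<in> borel_measurable M"
    "(\<lambda>w. k2 (g w) (h w) (i w)) \<in> borel_measurable M"
    using measurable_compose[OF t k_meas] measurable_compose[OF t k1_meas]
      measurable_compose[OF t k2_meas] by simp_all
qed

lemma phi_measurable [measurable]: "\<phi> \<in> borel_measurable borel"
  using borel_measurable_integrable[OF phi_integrable] by simp

definition mass where "mass = (\<integral>z. \<phi> z \<partial>lborel)"
definition moment where "moment = (\<integral>z. z * \<phi> z \<partial>lborel)"

lemma zphi_nonneg: "0 \<le> z * \<phi> z"
  using phi_nonneg[of z] phi_supp[of z] by (cases "z < 0") auto

lemma mass_nonneg: "0 \<le> mass" and moment_nonneg: "0 \<le> moment"
  by (simp_all add: mass_def moment_def phi_nonneg zphi_nonneg)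

text \<open>The mean change of \<open>f\<close> caused by exchanges of an ordered pair of sizes \<open>(x, y)\<close>: the inner
  integral of the collision operator.\<close>
definition pair_rate :: "(real \<Rightarrow> real) \<Rightarrow> real \<Rightarrow> real \<Rightarrow> real" where
  "pair_rate f x y = (\<integral>z. k x y z * exchange f x y z \<partial>lborel)"

end

locale tested_kernel = exchange_kernel + test_slope
begin

text \<open>For a slope bounded by 1, moving the amount \<open>z\<close> changes each of the two values of \<open>f\<close> by at most
  \<open>z\<close>; this turns every bound by \<open>\<phi> z\<close> into one by the integrable function \<open>z * \<phi> z\<close>.\<close>
lemma k_exchange_bound:
  assumes "0 \<le> x" "0 \<le> y"
  shows "\<bar>k x y z * exchange f x y z\<bar> \<le> 2 * C * (1 + x) * (1 + y) * (z * \<phi> z)"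
proof (cases "0 < z \<and> z \<le> x")
  case True
  then have "\<bar>k x y z\<bar> * \<bar>exchange f x y z\<bar> \<le> (C * (1 + x) * (1 + y) * \<phi> z) * (2 * z)"
    using k_le[OF assms, of z] exchange_bound[of z x y] assms k_nonneg[of x y z]
    by (intro mult_mono) auto
  then show ?thesis by (simp add: abs_mult algebra_simps)
next
  case False
  then show ?thesis using k_supp[of z x y] assms C_nonneg zphi_nonneg[of z] by simp
qed

lemma k1_exchange_bound:
  assumes "0 \<le> x" "0 \<le> y"
  shows "\<bar>k1 x y z * exchange f x y z\<bar> \<le> (1 + y) * (2 * (z * \<phi> z))"
proof (cases "0 < z \<and> z \<le> x")
  case True
  then have "\<bar>k1 x y z\<bar> * \<bar>exchange f x y z\<bar> \<le> ((1 + y) * \<phi> z) * (2 * z)"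
    using k1_le[OF assms, of z] exchange_bound[of z x y] assms
    by (intro mult_mono) auto
  then show ?thesis by (simp add: abs_mult algebra_simps)
next
  case False
  then show ?thesis using k1_supp[of z x y] assms zphi_nonneg[of z] by simp
qed

lemma k2_exchange_bound:
  assumes "0 \<le> x" "0 \<le> y"
  shows "\<bar>k2 x y z * exchange f x y z\<bar> \<le> (1 + x) * (2 * (z * \<phi> z))"
proof (cases "0 < z \<and> z \<le> x")
  case True
  then have "\<bar>k2 x y z\<bar> * \<bar>exchange f x y z\<bar> \<le> ((1 + x) * \<phi> z) * (2 * z)"
    using k2_le[OF assms, of z] exchange_bound[of z x y] assms
    by (intro mult_mono) auto
  then show ?thesis by (simp add: abs_mult algebra_simps)
next
  case False
  then show ?thesis using k2_supp[of z x y] assms zphi_nonneg[of z] by simp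
qed

lemma pair_rate_measurable [measurable]: "(\<lambda>(x, y). pair_rate f x y) \<in> borel_measurable (borel \<Otimes>\<^sub>M borel)"
  unfolding pair_rate_def by measurable

lemma pair_rate_bound: 
  assumes "0 \<le> x" "0 \<le> y"
  shows "\<bar>pair_rate f x y\<bar> \<le> 2 * C * moment * ((1 + x) * (1 + y))"
proof -
  have "\<bar>pair_rate f x y\<bar> \<le> (\<integral>z. 2 * C * (1 + x) * (1 + y) * (z * \<phi> z) \<partial>lborel)"
    unfolding pair_rate_def
    by (rule dominated_integral) (use zphi_integrable k_exchange_bound[OF assms] in auto)
  also have "\<dots> = 2 * C * (1 + x) * (1 + y) * moment"
    unfolding moment_def by (rule integral_mult_right_zero)
  finally show ?thesis by (simp only: mult_ac)
qed

lemma pair_rate_outside: "\<not> (0 < x \<and> 0 \<le> y) \<Longrightarrow> pair_rate f x y = 0"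
  unfolding pair_rate_def by (subst k_supp) auto

text \<open>Derivatives of \<open>pair_rate f x y\<close> in the first and in the second size, in the integrated sense
  of \<open>pair_rate_fst\<close> and \<open>pair_rate_snd\<close>. In each, one term has the derivative on the kernel and
  the other has it on the test function.\<close>
definition flux1 :: "real \<Rightarrow> real \<Rightarrow> real" where
  "flux1 y u = (\<integral>z. k1 u y z * exchange f u y z + k u y z * (p (u - z) - p u) \<partial>lborel)"

definition flux2 :: "real \<Rightarrow> real \<Rightarrow> real" where
  "flux2 x v = (\<integral>z. k2 x v z * exchange f x v z + k x v z * (p (v + z) - p v) \<partial>lborel)"

lemma flux_measurable [measurable]:
  "flux1 y \<in> borel_measurable borel" "flux2 x \<in> borel_measurable borel"
  unfolding flux1_def[abs_def] flux2_def[abs_def] by measurable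

lemma flux1_integrand_crude:
  assumes "0 \<le> u" "0 \<le> y"
  shows "\<bar>k1 u y z * exchange f u y z + k u y z * (p (u - z) - p u)\<bar>
    \<le> (1 + y) * (2 * (z * \<phi> z)) + 2 * C * (1 + u) * (1 + y) * \<phi> z"
proof -
  have "\<bar>k u y z\<bar> * \<bar>p (u - z) - p u\<bar> \<le> (C * (1 + u) * (1 + y) * \<phi> z) * 2"
    using k_le[OF assms, of z] k_nonneg[of u y z] slope_le_1[of "u - z"] slope_le_1[of u]
    by (intro mult_mono) auto
  also have "\<dots> = 2 * C * (1 + u) * (1 + y) * \<phi> z" by simp
  finally show ?thesis
    using k1_exchange_bound[OF assms, of z] by (intro order_trans[OF abs_triangle_ineq] add_mono) (simp_all add: abs_mult)
qed

lemma flux2_integrand_crude: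
  assumes "0 \<le> x" "0 \<le> v"
  shows "\<bar>k2 x v z * exchange f x v z + k x v z * (p (v + z) - p v)\<bar>
    \<le> (1 + x) * (2 * (z * \<phi> z)) + 2 * C * (1 + x) * (1 + v) * \<phi> z"
proof -
  have "\<bar>k x v z\<bar> * \<bar>p (v + z) - p v\<bar> \<le> (C * (1 + x) * (1 + v) * \<phi> z) * 2"
    using k_le[OF assms, of z] k_nonneg[of x v z] slope_le_1[of "v + z"] slope_le_1[of v]
    by (intro mult_mono) auto
  also have "\<dots> = 2 * C * (1 + x) * (1 + v) * \<phi> z" by simp
  finally show ?thesis
    using k2_exchange_bound[OF assms, of z] by (intro order_trans[OF abs_triangle_ineq] add_mono) (simp_all add: abs_mult)
qed

text \<open>The product rule on \<open>[z, x]\<close>, where the kernel factor starts from 0.\<close>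
lemma k_exchange_fst:
  assumes x: "0 \<le> x" and y: "0 \<le> y"
  shows "k x y z * exchange f x y z =
    (LINT u:{0..x}|lborel. k1 u y z * exchange f u y z + k u y z * (p (u - z) - p u))"
proof (cases "0 < z \<and> z \<le> x")
  case True
  have k1s: "set_integrable lborel {z..x} (\<lambda>u. k1 u y z)"
    by (rule bounded_set_integrable[where m="(1 + y) * \<phi> z"]) (use k1_le y True in auto)
  \<comment> \<open>The integral over a single point vanishes: this is where the boundary condition enters.\<close>
  have kz: "k z y z = 0"
  proof -
    have "(LINT u:{z..z}|lborel. k1 u y z) = 0"
      unfolding set_lebesgue_integral_def
      by (rule integral_eq_zero_AE, rule eventually_mono[OF AE_lborel_singleton[of z]]) auto
    then show ?thesis using k_fst[of z z y] True y by simp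
  qed
  have "k x y z * exchange f x y z - k z y z * exchange f z y z
      = (LINT u:{z..x}|lborel. k1 u y z * exchange f u y z + k u y z * (p (u - z) - p u))"
  proof (rule integral_product_rule[where A="\<lambda>u. k u y z" and B="\<lambda>u. exchange f u y z", OF _ k1s])
    show "z \<le> x" using True by simp
    show "k u y z = k z y z + (LINT v:{z..u}|lborel. k1 v y z)" if "u \<in> {z..x}" for u
      using k_fst[of z u y] kz that True y by simp
    show "exchange f u y z = exchange f z y z + (LINT v:{z..u}|lborel. p (v - z) - p v)"
      if "u \<in> {z..x}" for u
      by (rule exchange_fst) (use that True in auto)
    show "set_integrable lborel {z..x} (\<lambda>u. p (u - z) - p u)"
      using slope_shift_set_integrable[of z x "- z"] slope_set_integrable[of z x]
      by (simp add: set_integral_diff(1))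
  qed
  also have "\<dots> = (LINT u:{0..x}|lborel. k1 u y z * exchange f u y z + k u y z * (p (u - z) - p u))"
    unfolding set_lebesgue_integral_def
    by (rule Bochner_Integration.integral_cong)
       (use True k_supp[of z _ y] k1_supp[of z _ y] in \<open>auto split: split_indicator\<close>)
  finally show ?thesis using kz by simp
next
  case False
  then have z: "k u y z = 0" "k1 u y z = 0" if "u \<le> x" for u
    using k_supp[of z u y] k1_supp[of z u y] that by auto
  have "(LINT u:{0..x}|lborel. k1 u y z * exchange f u y z + k u y z * (p (u - z) - p u)) = (LINT u:{0..x}|lborel. 0)"
    by (rule set_lebesgue_integral_cong) (use z in auto)
  then show ?thesis using z by simp
qed

lemma k_exchange_snd:
  assumes x: "0 \<le> x" and y: "0 \<le> y"
  shows "k x y z * exchange f x y z = k x 0 z * exchange f x 0 z +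
    (LINT v:{0..y}|lborel. k2 x v z * exchange f x v z + k x v z * (p (v + z) - p v))"
proof (cases "0 < z \<and> z \<le> x")
  case True
  have k2s: "set_integrable lborel {0..y} (\<lambda>v. k2 x v z)"
    by (rule bounded_set_integrable[where m="(1 + x) * \<phi> z"]) (use k2_le x True in auto)
  have "k x y z * exchange f x y z - k x 0 z * exchange f x 0 z
      = (LINT v:{0..y}|lborel. k2 x v z * exchange f x v z + k x v z * (p (v + z) - p v))"
  proof (rule integral_product_rule[where A="\<lambda>v. k x v z" and B="\<lambda>v. exchange f x v z", OF y k2s])
    show "k x v z = k x 0 z + (LINT v:{0..v}|lborel. k2 x v z)" if "v \<in> {0..y}" for v
      by (rule k_snd) (use that True in auto)
    show "exchange f x v z = exchange f x 0 z + (LINT v:{0..v}|lborel. p (v + z) - p v)"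
      if "v \<in> {0..y}" for v
      by (rule exchange_snd) (use that True in auto)
    show "set_integrable lborel {0..y} (\<lambda>v. p (v + z) - p v)"
      using slope_shift_set_integrable[of 0 y z] slope_set_integrable[of 0 y]
      by (simp add: set_integral_diff(1))
  qed
  then show ?thesis by simp
next
  case False
  then have z: "k x v z = 0" "k2 x v z = 0" for v
    using k_supp[of z x v] k2_supp[of z x v] by auto
  then show ?thesis by simp
qed

lemma pair_rate_fst:
  assumes x: "0 \<le> x" and y: "0 \<le> y"
  shows "pair_rate f x y = (LINT u:{0..x}|lborel. flux1 y u)"
  unfolding pair_rate_def flux1_def k_exchange_fst[OF assms]
proof (rule set_integral_swap(2)[where g="\<lambda>z. (1 + y) * (2 * (z * \<phi> z)) + 2 * C * (1 + x) * (1 + y) * \<phi> z"])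
  fix u z assume u: "u \<in> {0..x}"
  have "2 * C * (1 + u) * (1 + y) * \<phi> z \<le> 2 * C * (1 + x) * (1 + y) * \<phi> z"
    using u y C_nonneg phi_nonneg[of z] by (intro mult_right_mono mult_left_mono) auto
  with flux1_integrand_crude[of u y z] u y
  show "\<bar>k1 u y z * exchange f u y z + k u y z * (p (u - z) - p u)\<bar>
    \<le> (1 + y) * (2 * (z * \<phi> z)) + 2 * C * (1 + x) * (1 + y) * \<phi> z" by auto
qed (use phi_integrable zphi_integrable in \<open>auto intro!: Bochner_Integration.integrable_add integrable_mult_right\<close>)

lemma pair_rate_snd:
  assumes x: "0 \<le> x" and y: "0 \<le> y"
  shows "pair_rate f x y = pair_rate f x 0 + (LINT v:{0..y}|lborel. flux2 x v)"
proof -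
  define g where "g z = (1 + x) * (2 * (z * \<phi> z)) + 2 * C * (1 + x) * (1 + y) * \<phi> z" for z
  define H where "H v z = k2 x v z * exchange f x v z + k x v z * (p (v + z) - p v)" for v z
  have g: "integrable lborel g"
    using phi_integrable zphi_integrable by (auto simp: g_def[abs_def])
  have Hm: "(\<lambda>(v, z). H v z) \<in> borel_measurable (borel \<Otimes>\<^sub>M borel)"
    unfolding H_def by measurable
  have bd: "\<bar>H v z\<bar> \<le> g z" if v: "v \<in> {0..y}" for v z
  proof -
    have "2 * C * (1 + x) * (1 + v) * \<phi> z \<le> 2 * C * (1 + x) * (1 + y) * \<phi> z"
      using v x C_nonneg phi_nonneg[of z] by (intro mult_right_mono mult_left_mono) auto
    with flux2_integrand_crude[of x v z] v x show ?thesis by (auto simp: H_def g_def)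
  qed
  have "integrable lborel (\<lambda>z. k x 0 z * exchange f x 0 z)"
    by (rule dominated_integral[where g="\<lambda>z. 2 * C * (1 + x) * (1 + 0) * (z * \<phi> z)"])
       (use zphi_integrable k_exchange_bound[OF x, of 0] in auto)
  moreover have "pair_rate f x y = (\<integral>z. k x 0 z * exchange f x 0 z + (LINT v:{0..y}|lborel. H v z) \<partial>lborel)"
    unfolding pair_rate_def k_exchange_snd[OF assms] H_def ..
  ultimately have "pair_rate f x y = pair_rate f x 0 + (\<integral>z. (LINT v:{0..y}|lborel. H v z) \<partial>lborel)"
    using set_integral_swap(1)[OF Hm g bd] by (simp add: pair_rate_def)
  also have "(\<integral>z. (LINT v:{0..y}|lborel. H v z) \<partial>lborel) = (LINT v:{0..y}|lborel. flux2 x v)"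
    using set_integral_swap(2)[OF Hm g bd] by (simp add: H_def flux2_def)
  finally show ?thesis .
qed

end

section \<open>Weighted sign functions and the dissipative estimate\<close>

text \<open>With slope \<open>sgn (S u)\<close> the factor \<open>1 + u\<close> in the kernel bound would have to be integrated
  against a tail, which needs a second moment. The weight tames this factor. Two properties make
  the choice work: \<open>(1 + u) * weight R u\<close> is bounded (by \<open>R\<close>), and the loss caused by the weight
  not being constant is controlled by \<open>z\<close> uniformly in \<open>R\<close>.\<close>
definition weight :: "real \<Rightarrow> real \<Rightarrow> real" where
  "weight R u = R / (R + u)"

lemma weight_bounds:
  assumes "1 \<le> R" "0 \<le> u"
  shows "0 \<le> weight R u" "weight R u \<le> 1" "(1 + u) * weight R u \<le> R"
proof -
  show "0 \<le> weight R u" "weight R u \<le> 1"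
    using assms by (auto simp: weight_def divide_simps)
  have "(1 + u) * R \<le> R * (R + u)"
    using assms by (simp add: mult.commute mult_right_mono)
  then show "(1 + u) * weight R u \<le> R"
    using assms by (simp add: weight_def divide_simps)
qed

lemma weight_antimono:
  assumes "1 \<le> R" "0 \<le> u" "u \<le> v"
  shows "weight R v \<le> weight R u"
  unfolding weight_def using assms by (intro divide_left_mono) auto

text \<open>The increment equals \<open>z\<close> times \<open>(1 + u) / (R + u)\<close> times \<open>R / (R + (u - z))\<close>, and both
  quotients are at most 1. The bound is free of \<open>R\<close>, hence survives the limit \<open>R \<rightarrow> \<infinity>\<close>.\<close>
lemma weight_increment:
  assumes "1 \<le> R" "0 \<le> z" "z \<le> u"
  shows "(1 + u) * (weight R (u - z) - weight R u) \<le> z"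
proof -
  have pos: "0 < R + u" "0 < R + (u - z)" using assms by auto
  have "(1 + u) * (weight R (u - z) - weight R u) = z * ((1 + u) / (R + u)) * (R / (R + (u - z)))"
    using pos by (simp add: weight_def divide_simps) (simp add: algebra_simps)
  also have "\<dots> \<le> z * 1 * 1"
    using assms pos by (intro mult_mono mult_nonneg_nonneg divide_nonneg_nonneg) auto
  finally show ?thesis by simp
qed

text \<open>In applications \<open>S\<close> is the difference of the tails of two solutions at a fixed time, for which
  the integral of \<open>p u * S u\<close> is a weighted \<open>L\<^sup>1\<close> norm.\<close>
locale weighted_kernel = tested_kernel +
  fixes R :: real and S :: "real \<Rightarrow> real"
  assumes R_ge_1: "1 \<le> R"
    and S_measurable [measurable]: "S \<in> borel_measurable borel"
    and slope_eq: "0 \<le> u \<Longrightarrow> p u = weight R u * sgn (S u)"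
begin

lemma slope_le_weight: "0 \<le> u \<Longrightarrow> \<bar>p u\<bar> \<le> weight R u"
  using weight_bounds[OF R_ge_1, of u] by (auto simp: slope_eq abs_mult sgn_if)

lemma slope_times_S: "0 \<le> u \<Longrightarrow> p u * S u = weight R u * \<bar>S u\<bar>"
  by (simp add: slope_eq sgn_if)

lemma slope_times_le: "0 \<le> v \<Longrightarrow> p v * s \<le> weight R v * \<bar>s\<bar>"
  using mult_right_mono[OF slope_le_weight[of v], of "\<bar>s\<bar>"] abs_ge_self[of "p v * s"]
  by (simp add: abs_mult)

text \<open>A crude bound that uses no sign; its constant grows with \<open>R\<close>. It makes the
  flux bounded, and in the estimates it is applied only to the small difference between \<open>S\<close> and
  the tail difference at a nearby time.\<close>
lemma k_slope_bound_fst: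
  assumes u: "0 \<le> u" and y: "0 \<le> y"
  shows "\<bar>k u y z * (p (u - z) - p u)\<bar> \<le> (1 + y) * (C * (z * \<phi> z + 2 * R * \<phi> z))"
proof (cases "0 < z \<and> z \<le> u")
  case True
  have "(1 + u) * \<bar>p (u - z) - p u\<bar> \<le> (1 + u) * ((weight R (u - z) - weight R u) + 2 * weight R u)"
    using slope_le_weight[of "u - z"] slope_le_weight[of u] True u
    by (intro mult_left_mono) auto
  also have "\<dots> = (1 + u) * (weight R (u - z) - weight R u) + 2 * ((1 + u) * weight R u)"
    by (simp add: algebra_simps)
  also have "\<dots> \<le> z + 2 * R"
    using weight_increment[OF R_ge_1, of z u] weight_bounds(3)[OF R_ge_1 u] True by auto
  finally have 1: "(1 + u) * \<bar>p (u - z) - p u\<bar> \<le> z + 2 * R" .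
  have "\<bar>k u y z * (p (u - z) - p u)\<bar> \<le> (C * (1 + u) * (1 + y) * \<phi> z) * \<bar>p (u - z) - p u\<bar>"
    unfolding abs_mult using k_le[OF u y, of z] k_nonneg[of u y z] by (intro mult_right_mono) auto
  also have "\<dots> = (C * (1 + y) * \<phi> z) * ((1 + u) * \<bar>p (u - z) - p u\<bar>)" by (simp only: mult_ac)
  also have "\<dots> \<le> (C * (1 + y) * \<phi> z) * (z + 2 * R)"
    using 1 C_nonneg phi_nonneg[of z] y by (intro mult_left_mono) auto
  finally show ?thesis by (simp add: algebra_simps)
next
  case False
  then show ?thesis
    using k_supp[of z u y] y C_nonneg zphi_nonneg[of z] phi_nonneg[of z] R_ge_1 by simp
qed

text \<open>The dissipative term. Since \<open>p u * S u\<close> is the largest value that a slope of weight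
  \<open>weight R u\<close> can give, \<open>p (u - z) - p u\<close> works against \<open>S u\<close> except for the increment
  of the weight. The growth of the kernel in \<open>u\<close> is thereby absorbed with a constant independent
  of \<open>R\<close>.\<close>
lemma k_slope_dissipation_fst:
  assumes u: "0 \<le> u" and y: "0 \<le> y"
  shows "k u y z * (p (u - z) - p u) * S u \<le> (1 + y) * (C * (z * \<phi> z) * \<bar>S u\<bar>)"
proof (cases "0 < z \<and> z \<le> u")
  case True
  have "k u y z * (p (u - z) - p u) * S u = k u y z * (p (u - z) * S u - p u * S u)"
    by (simp add: algebra_simps)
  also have "\<dots> \<le> k u y z * (weight R (u - z) * \<bar>S u\<bar> - weight R u * \<bar>S u\<bar>)"
    using slope_times_le[of "u - z" "S u"] slope_times_S[OF u] True k_nonneg[of u y z]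
    by (intro mult_left_mono) auto
  also have "\<dots> = k u y z * ((weight R (u - z) - weight R u) * \<bar>S u\<bar>)"
    by (simp add: algebra_simps)
  also have "\<dots> \<le> (C * (1 + u) * (1 + y) * \<phi> z) * ((weight R (u - z) - weight R u) * \<bar>S u\<bar>)"
    using k_le[OF u y, of z] weight_antimono[OF R_ge_1, of "u - z" u] True
    by (intro mult_right_mono) auto
  also have "\<dots> = (C * (1 + y) * \<phi> z * \<bar>S u\<bar>) * ((1 + u) * (weight R (u - z) - weight R u))"
    by (simp only: mult_ac)
  also have "\<dots> \<le> (C * (1 + y) * \<phi> z * \<bar>S u\<bar>) * z"
    using weight_increment[OF R_ge_1, of z u] True C_nonneg phi_nonneg[of z] y
    by (intro mult_left_mono) auto
  finally show ?thesis by (simp only: mult_ac)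
next
  case False
  then show ?thesis
    using k_supp[of z u y] y C_nonneg zphi_nonneg[of z] by simp
qed

lemma k_slope_bound_snd:
  assumes x: "0 \<le> x" and v: "0 \<le> v"
  shows "\<bar>k x v z * (p (v + z) - p v)\<bar> \<le> (1 + x) * (C * (z * \<phi> z + 2 * R * \<phi> z))"
proof (cases "0 < z \<and> z \<le> x")
  case True
  have "(1 + v) * \<bar>p (v + z) - p v\<bar> \<le> (1 + v) * (2 * weight R v)"
    using slope_le_weight[of "v + z"] slope_le_weight[of v] weight_antimono[OF R_ge_1, of v "v + z"] True v
    by (intro mult_left_mono) auto
  also have "\<dots> \<le> 2 * R"
    using weight_bounds(3)[OF R_ge_1 v] by auto
  finally have 1: "(1 + v) * \<bar>p (v + z) - p v\<bar> \<le> z + 2 * R" using True by simp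
  have "\<bar>k x v z * (p (v + z) - p v)\<bar> \<le> (C * (1 + x) * (1 + v) * \<phi> z) * \<bar>p (v + z) - p v\<bar>"
    unfolding abs_mult using k_le[OF x v, of z] k_nonneg[of x v z] by (intro mult_right_mono) auto
  also have "\<dots> = (C * (1 + x) * \<phi> z) * ((1 + v) * \<bar>p (v + z) - p v\<bar>)" by (simp only: mult_ac)
  also have "\<dots> \<le> (C * (1 + x) * \<phi> z) * (z + 2 * R)"
    using 1 C_nonneg phi_nonneg[of z] x by (intro mult_left_mono) auto
  finally show ?thesis by (simp add: algebra_simps)
next
  case False
  then show ?thesis
    using k_supp[of z x v] x v C_nonneg zphi_nonneg[of z] phi_nonneg[of z] R_ge_1 by simp
qed

text \<open>The recipient moves to the right, where the weight is smaller, so that the term is even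
  nonpositive; the weaker bound is stated for symmetry with the donor.\<close>
lemma k_slope_dissipation_snd:
  assumes x: "0 \<le> x" and v: "0 \<le> v"
  shows "k x v z * (p (v + z) - p v) * S v \<le> (1 + x) * (C * (z * \<phi> z) * \<bar>S v\<bar>)"
proof (cases "0 < z \<and> z \<le> x")
  case True
  have "weight R (v + z) * \<bar>S v\<bar> \<le> weight R v * \<bar>S v\<bar>"
    using weight_antimono[OF R_ge_1, of v "v + z"] True v by (intro mult_right_mono) auto
  then have "(p (v + z) - p v) * S v \<le> 0"
    using slope_times_le[of "v + z" "S v"] slope_times_S[OF v] True v by (simp add: left_diff_distrib)
  then have "k x v z * ((p (v + z) - p v) * S v) \<le> 0"
    using k_nonneg[of x v z] by (simp add: mult_nonneg_nonpos)
  moreover have "0 \<le> (1 + x) * (C * (z * \<phi> z) * \<bar>S v\<bar>)"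
    using x C_nonneg zphi_nonneg[of z] by simp
  ultimately show ?thesis by (simp only: mult.assoc)
next
  case False
  then show ?thesis
    using k_supp[of z x v] x v C_nonneg zphi_nonneg[of z] by simp
qed

text \<open>The bound for the flux against a tail difference \<open>D\<close> when the test function was built from
  \<open>s\<close>: only the last term, which vanishes for \<open>D = s\<close>, depends on \<open>R\<close>.\<close>
definition defect :: "real \<Rightarrow> real \<Rightarrow> real" where
  "defect D s = 2 * moment * \<bar>D\<bar> + C * moment * \<bar>s\<bar> + C * (moment + 2 * R * mass) * \<bar>D - s\<bar>"

lemma defect_nonneg: "0 \<le> defect D s"
  using moment_nonneg mass_nonneg C_nonneg R_ge_1 by (simp add: defect_def)

text \<open>Here \<open>a\<close> carries the derivative of the kernel and \<open>b\<close> that of the test function. Writing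
  \<open>D = s + (D - s)\<close> in the second term, the dissipative bound serves for \<open>s\<close> and the crude bound for
  \<open>D - s\<close>.\<close>
lemma flux_estimates:
  fixes a b :: "real \<Rightarrow> real" and e s D :: real
  assumes [measurable]: "a \<in> borel_measurable borel" "b \<in> borel_measurable borel"
    and e: "0 \<le> e"
    and a: "\<And>z. \<bar>a z\<bar> \<le> e * (2 * (z * \<phi> z))"
    and b: "\<And>z. \<bar>b z\<bar> \<le> e * (C * (z * \<phi> z + 2 * R * \<phi> z))"
    and bs: "\<And>z. b z * s \<le> e * (C * (z * \<phi> z) * \<bar>s\<bar>)"
  shows "\<bar>\<integral>z. a z + b z \<partial>lborel\<bar> \<le> e * (2 * moment + C * (moment + 2 * R * mass))"
    and "(\<integral>z. a z + b z \<partial>lborel) * D \<le> e * defect D s"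
proof -
  note ints = phi_integrable zphi_integrable
  define h where "h z = (e * (2 + C)) * (z * \<phi> z) + (e * C * 2 * R) * \<phi> z" for z
  have h: "integrable lborel h" unfolding h_def[abs_def] using ints by simp
  have m: "(\<lambda>z. a z + b z) \<in> borel_measurable lborel" by simp
  have ab_h: "\<bar>a z + b z\<bar> \<le> h z" for z
    using a[of z] b[of z] abs_triangle_ineq[of "a z" "b z"] by (simp add: h_def algebra_simps)
  note ab = dominated_integral[OF m h ab_h]
  have "(\<integral>z. h z \<partial>lborel) = (e * (2 + C)) * moment + (e * C * 2 * R) * mass"
    using ints by (simp add: h_def moment_def mass_def)
  with ab(2) show "\<bar>\<integral>z. a z + b z \<partial>lborel\<bar> \<le> e * (2 * moment + C * (moment + 2 * R * mass))"
    by (simp add: algebra_simps)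
  define c1 where "c1 = e * (2 * \<bar>D\<bar> + C * \<bar>s\<bar> + C * \<bar>D - s\<bar>)"
  define c2 where "c2 = e * C * 2 * R * \<bar>D - s\<bar>"
  have pt: "(a z + b z) * D \<le> c1 * (z * \<phi> z) + c2 * \<phi> z" for z
  proof -
    have "a z * D \<le> e * (2 * (z * \<phi> z)) * \<bar>D\<bar>"
      using mult_right_mono[OF a[of z], of "\<bar>D\<bar>"] abs_ge_self[of "a z * D"] by (simp add: abs_mult)
    moreover have "b z * (D - s) \<le> e * (C * (z * \<phi> z + 2 * R * \<phi> z)) * \<bar>D - s\<bar>"
      using mult_right_mono[OF b[of z], of "\<bar>D - s\<bar>"] abs_ge_self[of "b z * (D - s)"]
      by (simp add: abs_mult)
    moreover have "(a z + b z) * D = a z * D + b z * (D - s) + b z * s"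
      by (simp add: algebra_simps)
    ultimately have "(a z + b z) * D \<le> e * (2 * (z * \<phi> z)) * \<bar>D\<bar>
        + e * (C * (z * \<phi> z + 2 * R * \<phi> z)) * \<bar>D - s\<bar> + e * (C * (z * \<phi> z) * \<bar>s\<bar>)"
      using bs[of z] by linarith
    also have "\<dots> = c1 * (z * \<phi> z) + c2 * \<phi> z"
      by (simp add: c1_def c2_def algebra_simps)
    finally show ?thesis .
  qed
  have "(\<integral>z. a z + b z \<partial>lborel) * D = (\<integral>z. (a z + b z) * D \<partial>lborel)"
    using integral_mult_left_zero[of lborel "\<lambda>z. a z + b z" D] by simp
  also have "\<dots> \<le> (\<integral>z. c1 * (z * \<phi> z) + c2 * \<phi> z \<partial>lborel)"
    by (rule integral_mono) (use ab(1) ints pt in auto)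
  also have "\<dots> = c1 * moment + c2 * mass"
    using ints by (simp add: moment_def mass_def)
  also have "\<dots> = e * defect D s"
    by (simp add: c1_def c2_def defect_def algebra_simps)
  finally show "(\<integral>z. a z + b z \<partial>lborel) * D \<le> e * defect D s" .
qed

lemma flux1_estimates:
  assumes "0 \<le> u" "0 \<le> y"
  shows "\<bar>flux1 y u\<bar> \<le> (1 + y) * (2 * moment + C * (moment + 2 * R * mass))"
    and "flux1 y u * D \<le> (1 + y) * defect D (S u)"
  unfolding flux1_def
  by (rule flux_estimates[where s="S u"];
      use assms k1_exchange_bound[OF assms] k_slope_bound_fst[OF assms] k_slope_dissipation_fst[OF assms] in simp)+

lemma flux2_estimates:
  assumes "0 \<le> x" "0 \<le> v"
  shows "\<bar>flux2 x v\<bar> \<le> (1 + x) * (2 * moment + C * (moment + 2 * R * mass))"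
    and "flux2 x v * D \<le> (1 + x) * defect D (S v)"
  unfolding flux2_def
  by (rule flux_estimates[where s="S v"];
      use assms k2_exchange_bound[OF assms] k_slope_bound_snd[OF assms] k_slope_dissipation_snd[OF assms] in simp)+

lemma defect_tails_integrable:
  assumes "halfline_law M" "halfline_law N" and S: "integrable lborel S"
  shows "integrable lborel (\<lambda>u. defect (tail M u - tail N u) (S u))"
proof -
  interpret M: halfline_law M by fact
  interpret N: halfline_law N by fact
  show ?thesis unfolding defect_def using M.tail_integrable N.tail_integrable S by auto
qed

text \<open>Integration by parts in the variable that carries the difference of the two laws; the constant
  \<open>g 0\<close> cancels because both laws have mass 1.\<close>
lemma flux_tails_le:
  fixes q g :: "real \<Rightarrow> real"
  assumes laws: "halfline_law M" "halfline_law N" and S: "integrable lborel S"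
    and q: "q \<in> borel_measurable borel" and g: "g \<in> borel_measurable borel"
    and bd: "\<And>u. 0 \<le> u \<Longrightarrow> \<bar>q u\<bar> \<le> b"
    and le: "\<And>u D. 0 \<le> u \<Longrightarrow> q u * D \<le> e * defect D (S u)" and e: "0 \<le> e"
    and eq: "\<And>x. 0 \<le> x \<Longrightarrow> g x = g 0 + (LINT u:{0..x}|lborel. q u)"
  shows "(\<integral>x. g x \<partial>M) - (\<integral>x. g x \<partial>N) \<le> e * (\<integral>u. defect (tail M u - tail N u) (S u) \<partial>lborel)"
proof -
  interpret M: halfline_law M by fact
  interpret N: halfline_law N by fact
  note M = M.tail_by_parts[OF q bd g eq] and N = N.tail_by_parts[OF q bd g eq]
  have "(\<integral>x. g x \<partial>M) - (\<integral>x. g x \<partial>N) = (\<integral>u. q u * tail M u - q u * tail N u \<partial>lborel)"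
    using M N by simp
  also have "\<dots> \<le> (\<integral>u. e * defect (tail M u - tail N u) (S u) \<partial>lborel)"
  proof (rule integral_mono)
    fix u :: real
    show "q u * tail M u - q u * tail N u \<le> e * defect (tail M u - tail N u) (S u)"
    proof (cases "0 \<le> u")
      case True
      then show ?thesis using le[of u "tail M u - tail N u"] by (simp add: right_diff_distrib)
    next
      case False
      then show ?thesis using defect_nonneg e by (simp add: tail_def)
    qed
  qed (use M(2) N(2) defect_tails_integrable[OF laws S] in auto)
  finally show ?thesis by simp
qed

lemma pair_rate_diff_fst:
  assumes "halfline_law M" "halfline_law N" "integrable lborel S" and y: "0 \<le> y"
  shows "(\<integral>x. pair_rate f x y \<partial>M) - (\<integral>x. pair_rate f x y \<partial>N)
    \<le> (1 + y) * (\<integral>u. defect (tail M u - tail N u) (S u) \<partial>lborel)"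
proof (rule flux_tails_le[OF assms(1-3)])
  show "pair_rate f x y = pair_rate f 0 y + (LINT u:{0..x}|lborel. flux1 y u)" if "0 \<le> x" for x
    using pair_rate_fst[OF that y] by (simp add: pair_rate_outside)
qed (use flux1_estimates y in auto)

lemma pair_rate_diff_snd:
  assumes "halfline_law M" "halfline_law N" "integrable lborel S" and x: "0 \<le> x"
  shows "(\<integral>y. pair_rate f x y \<partial>M) - (\<integral>y. pair_rate f x y \<partial>N)
    \<le> (1 + x) * (\<integral>u. defect (tail M u - tail N u) (S u) \<partial>lborel)"
proof (rule flux_tails_le[OF assms(1-3)])
  show "pair_rate f x y = pair_rate f x 0 + (LINT v:{0..y}|lborel. flux2 x v)" if "0 \<le> y" for y
    by (rule pair_rate_snd[OF x that])
qed (use flux2_estimates x in auto)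

end

context tested_kernel
begin

lemma pair_rate_abs_bound: "\<bar>pair_rate f x y\<bar> \<le> 2 * C * moment * ((1 + \<bar>x\<bar>) * (1 + \<bar>y\<bar>))"
proof (cases "0 < x \<and> 0 \<le> y")
  case True
  then show ?thesis using pair_rate_bound[of x y] by simp
next
  case False
  then show ?thesis using C_nonneg moment_nonneg by (simp add: pair_rate_outside)
qed

lemma pair_rate_integrable:
  assumes "halfline_law M" "halfline_law N"
  shows "integrable (M \<Otimes>\<^sub>M N) (\<lambda>(x, y). pair_rate f x y)"
proof -
  interpret M: halfline_law M by fact
  interpret N: halfline_law N by fact
  interpret P: pair_sigma_finite M N ..
  have "integrable (M \<Otimes>\<^sub>M N) (\<lambda>(x, y). (1 + \<bar>x\<bar>) * (1 + \<bar>y\<bar>))"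
    by (rule P.integrable_pair_times) (use M.first_moment N.first_moment in auto)
  then have "integrable (M \<Otimes>\<^sub>M N) (\<lambda>z. 2 * C * moment * (case z of (x, y) \<Rightarrow> (1 + \<bar>x\<bar>) * (1 + \<bar>y\<bar>)))"
    by (rule integrable_mult_right)
  then show ?thesis
    by (rule dominated_integral(1)[rotated]) (use pair_rate_abs_bound in auto)
qed

end

context exchange_kernel
begin

text \<open>The collision operator of the abstract kernel, for laws on the whole line.\<close>
definition Q_rate :: "real measure \<Rightarrow> (real \<Rightarrow> real) \<Rightarrow> real" where
  "Q_rate M f = (\<integral>x. (\<integral>y. pair_rate f x y \<partial>M) \<partial>M)"

end

lemma (in tested_kernel) Q_rate_bound:
  assumes "halfline_law M"
  shows "\<bar>Q_rate M f\<bar> \<le> 2 * C * moment * (1 + (\<integral>x. x \<partial>M))\<^sup>2"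
proof -
  interpret M: halfline_law M by fact
  interpret P: pair_sigma_finite M M ..
  have abs_mean: "(\<integral>x. \<bar>x\<bar> \<partial>M) = (\<integral>x. x \<partial>M)"
    by (rule integral_cong_AE) (use M.nonneg in auto)
  have I: "integrable M (\<lambda>x. 1 + \<bar>x\<bar>)" and E: "(\<integral>x. 1 + \<bar>x\<bar> \<partial>M) = 1 + (\<integral>x. x \<partial>M)"
    using M.first_moment M.prob_space abs_mean by auto
  have inner: "\<bar>\<integral>y. pair_rate f x y \<partial>M\<bar> \<le> 2 * C * moment * (1 + (\<integral>x. x \<partial>M)) * (1 + \<bar>x\<bar>)" for x
  proof -
    have "\<bar>\<integral>y. pair_rate f x y \<partial>M\<bar> \<le> (\<integral>y. 2 * C * moment * (1 + \<bar>x\<bar>) * (1 + \<bar>y\<bar>) \<partial>M)"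
      by (rule dominated_integral) (use pair_rate_abs_bound[of x] I in \<open>auto simp: mult.assoc\<close>)
    also have "\<dots> = 2 * C * moment * (1 + \<bar>x\<bar>) * (1 + (\<integral>x. x \<partial>M))"
      by (subst integral_mult_right_zero) (simp only: E)
    finally show ?thesis by (simp only: mult_ac)
  qed
  have "\<bar>Q_rate M f\<bar> \<le> (\<integral>x. 2 * C * moment * (1 + (\<integral>x. x \<partial>M)) * (1 + \<bar>x\<bar>) \<partial>M)"
    unfolding Q_rate_def by (rule dominated_integral) (use inner I in auto)
  also have "\<dots> = 2 * C * moment * (1 + (\<integral>x. x \<partial>M)) * (1 + (\<integral>x. x \<partial>M))"
    by (subst integral_mult_right_zero) (simp only: E)
  finally show ?thesis by (simp add: power2_eq_square mult_ac)
qed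

text \<open>The bilinear splitting \<open>M \<otimes> M - N \<otimes> N = (M - N) \<otimes> M + N \<otimes> (M - N)\<close>: the first summand is
  estimated in the donor variable for fixed recipient, the second one in the recipient variable for
  fixed donor.\<close>
lemma (in weighted_kernel) Q_rate_diff:
  assumes laws: "halfline_law M" "halfline_law N" and S: "integrable lborel S"
  shows "Q_rate M f - Q_rate N f \<le> (2 + (\<integral>x. x \<partial>M) + (\<integral>x. x \<partial>N))
    * (\<integral>u. defect (tail M u - tail N u) (S u) \<partial>lborel)"
proof -
  interpret M: halfline_law M by fact
  interpret N: halfline_law N by fact
  interpret MM: pair_sigma_finite M M ..
  interpret NM: pair_sigma_finite N M ..
  interpret NN: pair_sigma_finite N N ..
  let ?\<Delta> = "\<integral>u. defect (tail M u - tail N u) (S u) \<partial>lborel"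
  note MM = pair_rate_integrable[OF laws(1,1)] and NM = pair_rate_integrable[OF laws(2,1)]
    and NN = pair_rate_integrable[OF laws(2,2)]
  have iMM: "integrable M (\<lambda>y. \<integral>x. pair_rate f x y \<partial>M)" and iNM: "integrable M (\<lambda>y. \<integral>x. pair_rate f x y \<partial>N)"
    using MM.integrable_snd[OF MM] NM.integrable_snd[OF NM] by auto
  have jNM: "integrable N (\<lambda>x. \<integral>y. pair_rate f x y \<partial>M)" and jNN: "integrable N (\<lambda>x. \<integral>y. pair_rate f x y \<partial>N)"
    using NM.integrable_fst'[OF NM] NN.integrable_fst'[OF NN] by auto
  \<comment> \<open>The mixed term has its donor distributed by \<open>N\<close> and its recipient by \<open>M\<close>.\<close>
  have "Q_rate M f - (\<integral>x. (\<integral>y. pair_rate f x y \<partial>M) \<partial>N)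
      = (\<integral>y. (\<integral>x. pair_rate f x y \<partial>M) - (\<integral>x. pair_rate f x y \<partial>N) \<partial>M)"
    unfolding Q_rate_def
    using MM.Fubini_integral[OF MM] NM.Fubini_integral[OF NM] iMM iNM by simp
  also have "\<dots> \<le> (\<integral>y. (1 + y) * ?\<Delta> \<partial>M)"
    by (rule integral_mono_AE)
       (use iMM iNM M.first_moment M.nonneg pair_rate_diff_fst[OF laws S] in \<open>auto elim: eventually_mono\<close>)
  also have "\<dots> = (1 + (\<integral>x. x \<partial>M)) * ?\<Delta>"
    using M.first_moment M.prob_space by simp
  finally have 1: "Q_rate M f - (\<integral>x. (\<integral>y. pair_rate f x y \<partial>M) \<partial>N) \<le> (1 + (\<integral>x. x \<partial>M)) * ?\<Delta>" .
  have "(\<integral>x. (\<integral>y. pair_rate f x y \<partial>M) \<partial>N) - Q_rate N f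
      = (\<integral>x. (\<integral>y. pair_rate f x y \<partial>M) - (\<integral>y. pair_rate f x y \<partial>N) \<partial>N)"
    unfolding Q_rate_def using jNM jNN by simp
  also have "\<dots> \<le> (\<integral>x. (1 + x) * ?\<Delta> \<partial>N)"
    by (rule integral_mono_AE)
       (use jNM jNN N.first_moment N.nonneg pair_rate_diff_snd[OF laws S] in \<open>auto elim: eventually_mono\<close>)
  also have "\<dots> = (1 + (\<integral>x. x \<partial>N)) * ?\<Delta>"
    using N.first_moment N.prob_space by simp
  finally show ?thesis using 1 by (simp add: algebra_simps)
qed

section \<open>Tails determine the law\<close>

lemma (in halfline_law) integral_antideriv:
  assumes "test_slope p"
  shows "integrable M (antideriv p)" "integrable lborel (\<lambda>u. p u * tail M u)"
    "(\<integral>x. antideriv p x \<partial>M) = (\<integral>u. p u * tail M u \<partial>lborel)"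
proof -
  interpret test_slope p by fact
  have "antideriv p x = antideriv p 0 + (LINT u:{0..x}|lborel. p u)" if "0 \<le> x" for x
    using antideriv_add[OF _ that] by simp
  note parts = tail_by_parts[OF slope_measurable slope_le_1 antideriv_measurable this]
  show "integrable M (antideriv p)" "integrable lborel (\<lambda>u. p u * tail M u)"
    "(\<integral>x. antideriv p x \<partial>M) = (\<integral>u. p u * tail M u \<partial>lborel)"
    using parts by (simp_all add: antideriv_0)
qed

text \<open>On the line this is the Wasserstein-1 distance.\<close>
definition tail_distance :: "real measure \<Rightarrow> real measure \<Rightarrow> real" where
  "tail_distance M N = (\<integral>u. \<bar>tail M u - tail N u\<bar> \<partial>lborel)"

lemma cdf_eq_tail:
  assumes "halfline_law M" "0 \<le> u"
  shows "cdf M u = 1 - tail M u"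
proof -
  interpret halfline_law M by fact
  have "prob (space M - {..u}) = 1 - prob {..u}"
    by (rule prob_compl) simp
  moreover have "space M - {..u} = {u<..}" by auto
  ultimately show ?thesis using assms(2) by (simp add: cdf_def tail_def)
qed

lemma cdf_negative:
  assumes "halfline_law M" "u < 0"
  shows "cdf M u = 0"
proof -
  interpret halfline_law M by fact
  have "AE x in M. x \<notin> {..u}"
    using nonneg assms(2) by (auto elim!: eventually_mono)
  then have "emeasure M {..u} = 0"
    by (subst (asm) AE_iff_measurable[where N="{..u}"]) auto
  then show ?thesis by (simp add: cdf_def measure_def)
qed

text \<open>Distribution functions that agree almost everywhere agree everywhere by right continuity: a
  difference at \<open>u\<close> would persist on an interval \<open>(u, b)\<close> of positive length.\<close>
lemma tail_distance_0_imp_eq: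
  assumes M: "halfline_law M" and N: "halfline_law N" and 0: "tail_distance M N = 0"
  shows "M = N"
proof -
  interpret M: halfline_law M by fact
  interpret N: halfline_law N by fact
  have "AE u in lborel. \<bar>tail M u - tail N u\<bar> = 0"
    using 0 M.tail_integrable N.tail_integrable
    unfolding tail_distance_def by (subst (asm) integral_nonneg_eq_0_iff_AE) auto
  then have ae: "AE u in lborel. 0 \<le> u \<longrightarrow> cdf M u = cdf N u"
    by (rule eventually_mono) (simp add: cdf_eq_tail M N)
  have "cdf M u = cdf N u" for u
  proof (cases "0 \<le> u")
    case True
    show ?thesis
    proof (rule ccontr)
      assume ne: "cdf M u \<noteq> cdf N u"
      have "((\<lambda>y. cdf M y - cdf N y) \<longlongrightarrow> cdf M u - cdf N u) (at_right u)"
        using M.cdf_is_right_cont[of u] N.cdf_is_right_cont[of u]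
        by (intro tendsto_diff) (simp_all add: continuous_within)
      then have "eventually (\<lambda>y. cdf M y - cdf N y \<noteq> 0) (at_right u)"
        by (rule tendsto_imp_eventually_ne) (use ne in simp)
      then obtain b where b: "u < b" "\<And>y. u < y \<Longrightarrow> y < b \<Longrightarrow> cdf M y \<noteq> cdf N y"
        by (auto simp: eventually_at_right_field)
      have "AE y in lborel. y \<notin> {u<..<b}"
        using ae by (rule eventually_mono) (use b True in auto)
      then have "emeasure lborel {u<..<b} = 0"
        by (subst (asm) AE_iff_measurable[where N="{u<..<b}"]) auto
      then show False using b(1) by simp
    qed
  qed (simp add: cdf_negative M N)
  then show ?thesis
    by (intro cdf_unique ext M.real_distribution_axioms N.real_distribution_axioms)
qed

section \<open>Stability of solution curves in time\<close>

text \<open>Over \<open>n\<close> equal steps the quadratic errors add up to \<open>\<beta> * (t - s)\<^sup>2 / n\<close>.\<close>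
lemma rate_bound_from_partition:
  fixes h :: "real \<Rightarrow> real"
  assumes st: "s \<le> t"
    and rate: "\<And>a b. s \<le> a \<Longrightarrow> a \<le> b \<Longrightarrow> b \<le> t \<Longrightarrow> h b - h a \<le> (b - a) * (\<alpha> + \<beta> * (b - a))"
  shows "h t - h s \<le> (t - s) * \<alpha>"
proof (rule LIMSEQ_le_const)
  show "(\<lambda>n. (t - s) * \<alpha> + \<beta> * (t - s)\<^sup>2 * inverse (real (Suc n))) \<longlonglongrightarrow> (t - s) * \<alpha>"
    using tendsto_add[OF tendsto_const tendsto_mult[OF tendsto_const LIMSEQ_inverse_real_of_nat]]
    by fastforce
  show "\<exists>N. \<forall>n\<ge>N. h t - h s \<le> (t - s) * \<alpha> + \<beta> * (t - s)\<^sup>2 * inverse (real (Suc n))"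
  proof (intro exI allI impI)
    fix n :: nat
    define m where "m = Suc n"
    define d where "d = (t - s) / real m"
    have d: "0 \<le> d" "real m * d = t - s" using st by (auto simp: d_def m_def)
    have step: "h (s + real (Suc i) * d) - h (s + real i * d) \<le> d * (\<alpha> + \<beta> * d)" if "i < m" for i
    proof -
      have "real (Suc i) * d \<le> real m * d" using that d by (intro mult_right_mono) auto
      then show ?thesis
        using rate[of "s + real i * d" "s + real (Suc i) * d"] d by (simp add: algebra_simps)
    qed
    have "h t - h s = (\<Sum>i<m. h (s + real (Suc i) * d) - h (s + real i * d))"
      using sum_lessThan_telescope[of "\<lambda>i. h (s + real i * d)" m] d by simp
    also have "\<dots> \<le> (\<Sum>i<m. d * (\<alpha> + \<beta> * d))" by (rule sum_mono) (use step in auto)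
    also have "\<dots> = (real m * d) * (\<alpha> + \<beta> * d)" by simp
    also have "\<dots> = (t - s) * \<alpha> + \<beta> * (t - s)\<^sup>2 * inverse (real m)"
      unfolding d(2) by (simp add: d_def power2_eq_square field_simps)
    finally show "h t - h s \<le> (t - s) * \<alpha> + \<beta> * (t - s)\<^sup>2 * inverse (real (Suc n))"
      by (simp add: m_def)
  qed
qed

text \<open>A solution of the weak equation, tested only with functions given by a bounded slope.\<close>
locale exchange_curve = exchange_kernel +
  fixes M :: "real \<Rightarrow> real measure" and \<rho> :: real
  assumes law: "0 \<le> t \<Longrightarrow> halfline_law (M t)"
    and mean: "0 \<le> t \<Longrightarrow> (\<integral>x. x \<partial>M t) = \<rho>"
    and evolution_integrable: "test_slope p \<Longrightarrow> 0 \<le> s \<Longrightarrow> s \<le> t \<Longrightarrow>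
      set_integrable lborel {s..t} (\<lambda>r. Q_rate (M r) (antideriv p))"
    and evolution: "test_slope p \<Longrightarrow> 0 \<le> s \<Longrightarrow> s \<le> t \<Longrightarrow>
      (\<integral>x. antideriv p x \<partial>M t) - (\<integral>x. antideriv p x \<partial>M s)
        = (LINT r:{s..t}|lborel. Q_rate (M r) (antideriv p))"
begin

text \<open>Testing with the slope \<open>sgn (tail (M t) u - tail (M s) u)\<close> turns the distance into an increment
  of the curve, and the collision operator is bounded on functions of slope at most 1.\<close>
lemma tail_distance_time:
  assumes "0 \<le> s" "s \<le> t"
  shows "tail_distance (M t) (M s) \<le> 2 * C * moment * (1 + \<rho>)\<^sup>2 * (t - s)"
proof -
  interpret T: halfline_law "M t" by (rule law) (use assms in simp)
  interpret S: halfline_law "M s" by (rule law) (use assms in simp)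
  define p where "p u = sgn (tail (M t) u - tail (M s) u)" for u
  interpret P: test_slope p
    by unfold_locales (auto simp: p_def[abs_def] sgn_if)
  interpret tested_kernel k k1 k2 \<phi> C p ..
  have "tail_distance (M t) (M s) = (\<integral>u. p u * tail (M t) u - p u * tail (M s) u \<partial>lborel)"
    unfolding tail_distance_def
    by (rule Bochner_Integration.integral_cong) (auto simp: p_def sgn_if)
  also have "\<dots> = (\<integral>x. antideriv p x \<partial>M t) - (\<integral>x. antideriv p x \<partial>M s)"
    using T.integral_antideriv[OF P.test_slope_axioms] S.integral_antideriv[OF P.test_slope_axioms]
    by simp
  also have "\<dots> = (LINT r:{s..t}|lborel. Q_rate (M r) (antideriv p))"
    by (rule evolution[OF P.test_slope_axioms assms])
  also have "\<dots> \<le> (t - s) * (2 * C * moment * (1 + \<rho>)\<^sup>2)"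
  proof (rule set_integral_le_const[OF assms(2) evolution_integrable[OF P.test_slope_axioms assms]])
    fix r assume "r \<in> {s..t}"
    then show "Q_rate (M r) (antideriv p) \<le> 2 * C * moment * (1 + \<rho>)\<^sup>2"
      using Q_rate_bound[OF law, of r] mean[of r] assms by auto
  qed
  finally show ?thesis by (simp add: mult_ac)
qed

end

locale exchange_curve_pair = M: exchange_curve k k1 k2 \<phi> C M \<rho> + N: exchange_curve k k1 k2 \<phi> C N \<rho>
  for k k1 k2 \<phi> C M N \<rho>
begin

abbreviation gap :: "real \<Rightarrow> real \<Rightarrow> real" where
  "gap t u \<equiv> tail (M t) u - tail (N t) u"

definition weighted_distance :: "real \<Rightarrow> real \<Rightarrow> real" where
  "weighted_distance R t = (\<integral>u. weight R u * \<bar>gap t u\<bar> \<partial>lborel)"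

abbreviation distance :: "real \<Rightarrow> real" where
  "distance t \<equiv> tail_distance (M t) (N t)"

lemma gap_integrable: "0 \<le> t \<Longrightarrow> integrable lborel (gap t)"
  using halfline_law.tail_integrable[OF M.law] halfline_law.tail_integrable[OF N.law] by auto

lemma gap_measurable: "0 \<le> t \<Longrightarrow> gap t \<in> borel_measurable borel"
  using borel_measurable_integrable[OF gap_integrable] by simp

lemma gap_negative: "u < 0 \<Longrightarrow> gap t u = 0"
  by (simp add: tail_def)

lemma weighted_gap:
  assumes R: "1 \<le> R" and t: "0 \<le> t"
  shows "integrable lborel (\<lambda>u. weight R u * \<bar>gap t u\<bar>)"
    "weight R u * \<bar>gap t u\<bar> \<le> \<bar>gap t u\<bar>" "0 \<le> weight R u * \<bar>gap t u\<bar>"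
proof -
  note [measurable] = gap_measurable[OF t]
  show le: "weight R u * \<bar>gap t u\<bar> \<le> \<bar>gap t u\<bar>" for u
    using weight_bounds[OF R, of u] gap_negative[of u t]
    by (cases "0 \<le> u") (auto intro: mult_left_le_one_le)
  show ge: "0 \<le> weight R u * \<bar>gap t u\<bar>" for u
    using weight_bounds[OF R, of u] gap_negative[of u t] by (cases "0 \<le> u") auto
  show "integrable lborel (\<lambda>u. weight R u * \<bar>gap t u\<bar>)"
  proof (rule dominated_integral(1)[where g="\<lambda>u. \<bar>gap t u\<bar>"])
    show "integrable lborel (\<lambda>u. \<bar>gap t u\<bar>)" using gap_integrable[OF t] by simp
    show "\<bar>weight R u * \<bar>gap t u\<bar>\<bar> \<le> \<bar>gap t u\<bar>" for u
      using le[of u] ge[of u] by (simp add: abs_of_nonneg)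
  qed (simp add: weight_def)
qed

lemma weighted_distance_le: "1 \<le> R \<Longrightarrow> 0 \<le> t \<Longrightarrow> weighted_distance R t \<le> distance t"
  unfolding weighted_distance_def tail_distance_def
  by (rule integral_mono) (use weighted_gap gap_integrable in auto)

text \<open>Letting the weight tend to 1 is allowed since the tails themselves are integrable.\<close>
lemma weighted_distance_tendsto:
  assumes t: "0 \<le> t"
  shows "(\<lambda>n. weighted_distance (real (Suc n)) t) \<longlonglongrightarrow> distance t"
  unfolding weighted_distance_def tail_distance_def
proof (rule integral_dominated_convergence)
  note [measurable] = gap_measurable[OF t]
  show "(\<lambda>u. \<bar>gap t u\<bar>) \<in> borel_measurable lborel" by simp
  show "(\<lambda>u. weight (real (Suc n)) u * \<bar>gap t u\<bar>) \<in> borel_measurable lborel" for n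
    unfolding weight_def by simp
  show "integrable lborel (\<lambda>u. \<bar>gap t u\<bar>)" using gap_integrable[OF t] by simp
  show "AE u in lborel. norm (weight (real (Suc n)) u * \<bar>gap t u\<bar>) \<le> \<bar>gap t u\<bar>" for n
    using weighted_gap[of "real (Suc n)" t] t by (intro AE_I2) (simp add: abs_of_nonneg)
  have "(\<lambda>n. weight (real (Suc n)) u) \<longlonglongrightarrow> 1" for u
    unfolding weight_def by real_asymp
  then show "AE u in lborel. (\<lambda>n. weight (real (Suc n)) u * \<bar>gap t u\<bar>) \<longlonglongrightarrow> \<bar>gap t u\<bar>"
    by (intro AE_I2) (metis mult_1 tendsto_mult_right)
qed

definition growth_rate :: real where
  "growth_rate = (2 + 2 * \<rho>) * (2 + C) * M.moment"

definition error_rate :: "real \<Rightarrow> real" where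
  "error_rate R = (2 + 2 * \<rho>) * (C * (M.moment + 2 * R * M.mass)) * (4 * C * M.moment * (1 + \<rho>)\<^sup>2)"

lemma rho_nonneg: "0 \<le> \<rho>"
proof -
  interpret halfline_law "M 0" by (rule M.law) simp
  have "0 \<le> (\<integral>x. x \<partial>M 0)" by (rule integral_nonneg_AE) (rule nonneg)
  then show ?thesis using M.mean[of 0] by simp
qed

text \<open>Both curves are Lipschitz in time, so their gap is Lipschitz in time with values in \<open>L\<^sup>1\<close>.\<close>
lemma gap_time:
  assumes "0 \<le> r" "r \<le> t"
  shows "(\<integral>u. \<bar>gap r u - gap t u\<bar> \<partial>lborel) \<le> 4 * C * M.moment * (1 + \<rho>)\<^sup>2 * (t - r)"
proof -
  have t: "0 \<le> t" using assms by simp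
  note ints = halfline_law.tail_integrable[OF M.law[OF t]] halfline_law.tail_integrable[OF N.law[OF t]]
    halfline_law.tail_integrable[OF M.law[OF assms(1)]] halfline_law.tail_integrable[OF N.law[OF assms(1)]]
  have "(\<integral>u. \<bar>gap r u - gap t u\<bar> \<partial>lborel)
      \<le> (\<integral>u. \<bar>tail (M t) u - tail (M r) u\<bar> + \<bar>tail (N t) u - tail (N r) u\<bar> \<partial>lborel)"
    by (rule integral_mono) (use ints in auto)
  also have "\<dots> = tail_distance (M t) (M r) + tail_distance (N t) (N r)"
    unfolding tail_distance_def using ints by simp
  finally show ?thesis
    using M.tail_distance_time[OF assms] N.tail_distance_time[OF assms] by simp
qed

text \<open>The test function is optimal for the later time \<open>t\<close> and frozen during the step, hence merely
  admissible at time \<open>s\<close>. At an intermediate time \<open>r\<close> it misses the optimal slope by an error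
  proportional to the distance between the gaps at times \<open>r\<close> and \<open>t\<close>, which is of order
  \<open>t - s\<close>. The constant of this error depends on \<open>R\<close>, the growth rate does not.\<close>
lemma weighted_distance_step:
  assumes R: "1 \<le> R" and st: "0 \<le> s" "s \<le> t"
    and V: "\<And>r. r \<in> {s..t} \<Longrightarrow> distance r \<le> V"
  shows "weighted_distance R t - weighted_distance R s
    \<le> (t - s) * (growth_rate * V + error_rate R * (t - s))"
proof -
  have t: "0 \<le> t" using st by simp
  note [measurable] = gap_measurable[OF t]
  define p where "p u = (if 0 \<le> u then weight R u * sgn (gap t u) else 0)" for u
  have p_abs: "\<bar>p u\<bar> \<le> 1" and p_weight: "0 \<le> u \<Longrightarrow> \<bar>p u\<bar> \<le> weight R u" for u
    using weight_bounds[OF R, of u] by (auto simp: p_def abs_mult sgn_if)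
  interpret P: test_slope p
  proof
    show "p \<in> borel_measurable borel" unfolding p_def[abs_def] weight_def by measurable
  qed (rule p_abs)
  interpret W: weighted_kernel k k1 k2 \<phi> C p R "gap t"
    by unfold_locales (use R in \<open>auto simp: p_def gap_measurable[OF t]\<close>)
  let ?f = "antideriv p"
  have ibp: "(\<integral>x. ?f x \<partial>M r) - (\<integral>x. ?f x \<partial>N r) = (\<integral>u. p u * gap r u \<partial>lborel)"
    and ibp_int: "integrable lborel (\<lambda>u. p u * gap r u)" if "0 \<le> r" for r
    using halfline_law.integral_antideriv[OF M.law[OF that] P.test_slope_axioms]
      halfline_law.integral_antideriv[OF N.law[OF that] P.test_slope_axioms]
    by (simp_all add: right_diff_distrib)
  have "weighted_distance R t = (\<integral>u. p u * gap t u \<partial>lborel)"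
    unfolding weighted_distance_def
    by (rule Bochner_Integration.integral_cong) (auto simp: p_def sgn_if gap_negative)
  moreover have "(\<integral>u. p u * gap s u \<partial>lborel) \<le> weighted_distance R s"
    unfolding weighted_distance_def
  proof (rule integral_mono[OF ibp_int[OF st(1)] weighted_gap(1)[OF R st(1)]])
    fix u
    show "p u * gap s u \<le> weight R u * \<bar>gap s u\<bar>"
    proof (cases "0 \<le> u")
      case True
      show ?thesis
        using mult_right_mono[OF p_weight[OF True], of "\<bar>gap s u\<bar>"] abs_ge_self[of "p u * gap s u"]
        by (simp add: abs_mult)
    qed (simp add: gap_negative)
  qed
  ultimately have "weighted_distance R t - weighted_distance R s
      \<le> ((\<integral>x. ?f x \<partial>M t) - (\<integral>x. ?f x \<partial>M s)) - ((\<integral>x. ?f x \<partial>N t) - (\<integral>x. ?f x \<partial>N s))"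
    using ibp[OF t] ibp[OF st(1)] by simp
  also have "\<dots> = (LINT r:{s..t}|lborel. M.Q_rate (M r) ?f - M.Q_rate (N r) ?f)"
    unfolding M.evolution[OF P.test_slope_axioms st] N.evolution[OF P.test_slope_axioms st]
    by (rule set_integral_diff(2)[symmetric])
       (rule M.evolution_integrable[OF P.test_slope_axioms st] N.evolution_integrable[OF P.test_slope_axioms st])+
  also have "\<dots> \<le> (t - s) * (growth_rate * V + error_rate R * (t - s))"
  proof (rule set_integral_le_const[OF st(2)])
    show "set_integrable lborel {s..t} (\<lambda>r. M.Q_rate (M r) ?f - M.Q_rate (N r) ?f)"
      by (rule set_integral_diff(1))
         (rule M.evolution_integrable[OF P.test_slope_axioms st] N.evolution_integrable[OF P.test_slope_axioms st])+
    fix r assume r: "r \<in> {s..t}"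
    then have r0: "0 \<le> r" using st by simp
    define m where "m = C * (M.moment + 2 * R * M.mass)"
    have m: "0 \<le> m"
      using M.C_nonneg M.moment_nonneg M.mass_nonneg R by (simp add: m_def)
    note gaps = gap_integrable[OF t] gap_integrable[OF r0]
    have "(\<integral>u. W.defect (gap r u) (gap t u) \<partial>lborel)
        = 2 * M.moment * distance r + C * M.moment * distance t + m * (\<integral>u. \<bar>gap r u - gap t u\<bar> \<partial>lborel)"
      unfolding W.defect_def tail_distance_def m_def[symmetric] using gaps by simp
    also have "\<dots> \<le> 2 * M.moment * V + C * M.moment * V + m * (4 * C * M.moment * (1 + \<rho>)\<^sup>2 * (t - s))"
    proof (intro add_mono mult_left_mono)
      have "4 * C * M.moment * (1 + \<rho>)\<^sup>2 * (t - r) \<le> 4 * C * M.moment * (1 + \<rho>)\<^sup>2 * (t - s)"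
        using r M.C_nonneg M.moment_nonneg by (intro mult_left_mono) auto
      then show "(\<integral>u. \<bar>gap r u - gap t u\<bar> \<partial>lborel) \<le> 4 * C * M.moment * (1 + \<rho>)\<^sup>2 * (t - s)"
        using gap_time[of r t] r r0 by simp
    qed (use V r st M.C_nonneg M.moment_nonneg m in auto)
    finally have D: "(\<integral>u. W.defect (gap r u) (gap t u) \<partial>lborel)
        \<le> 2 * M.moment * V + C * M.moment * V + m * (4 * C * M.moment * (1 + \<rho>)\<^sup>2 * (t - s))" .
    have "M.Q_rate (M r) ?f - M.Q_rate (N r) ?f
        \<le> (2 + \<rho> + \<rho>) * (\<integral>u. W.defect (gap r u) (gap t u) \<partial>lborel)"
      using W.Q_rate_diff[OF M.law[OF r0] N.law[OF r0] gap_integrable[OF t]]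
      by (simp add: M.mean[OF r0] N.mean[OF r0])
    also have "\<dots> \<le> (2 + \<rho> + \<rho>) * (2 * M.moment * V + C * M.moment * V + m * (4 * C * M.moment * (1 + \<rho>)\<^sup>2 * (t - s)))"
      using D rho_nonneg by (intro mult_left_mono) auto
    also have "\<dots> = growth_rate * V + error_rate R * (t - s)"
      by (simp add: growth_rate_def error_rate_def m_def algebra_simps)
    finally show "M.Q_rate (M r) ?f - M.Q_rate (N r) ?f \<le> growth_rate * V + error_rate R * (t - s)" .
  qed
  finally show ?thesis .
qed

lemma growth_rate_nonneg: "0 \<le> growth_rate"
  using rho_nonneg M.C_nonneg M.moment_nonneg by (simp add: growth_rate_def)

lemma distance_nonneg: "0 \<le> distance t"
  by (simp add: tail_distance_def)

text \<open>First the time step tends to 0 for fixed \<open>R\<close>, which removes the \<open>R\<close>-dependent error; then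
  \<open>R\<close> tends to infinity. The opposite order would fail.\<close>
lemma distance_growth:
  assumes st: "0 \<le> s" "s \<le> t" and 0: "distance s = 0"
    and V: "\<And>r. r \<in> {s..t} \<Longrightarrow> distance r \<le> V"
  shows "distance t \<le> (t - s) * (growth_rate * V)"
proof (rule LIMSEQ_le_const2[OF weighted_distance_tendsto])
  show "0 \<le> t" using st by simp
  show "\<exists>n0. \<forall>n\<ge>n0. weighted_distance (real (Suc n)) t \<le> (t - s) * (growth_rate * V)"
  proof (intro exI allI impI)
    fix n :: nat
    have "weighted_distance (real (Suc n)) t - weighted_distance (real (Suc n)) s \<le> (t - s) * (growth_rate * V)"
      by (rule rate_bound_from_partition[OF st(2), where \<beta>="error_rate (real (Suc n))"])
         (rule weighted_distance_step; use st V in auto)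
    moreover have "weighted_distance (real (Suc n)) s \<le> 0"
      using weighted_distance_le[of "real (Suc n)" s] st 0 by simp
    ultimately show "weighted_distance (real (Suc n)) t \<le> (t - s) * (growth_rate * V)" by simp
  qed
qed

lemma distance_le_twice_mean: "0 \<le> t \<Longrightarrow> distance t \<le> 2 * \<rho>"
proof -
  assume t: "0 \<le> t"
  interpret MT: halfline_law "M t" by (rule M.law[OF t])
  interpret NT: halfline_law "N t" by (rule N.law[OF t])
  have "distance t \<le> (\<integral>u. tail (M t) u + tail (N t) u \<partial>lborel)"
    unfolding tail_distance_def
  proof (rule integral_mono)
    fix u
    show "\<bar>gap t u\<bar> \<le> tail (M t) u + tail (N t) u"
      using MT.tail_nonneg[of u] NT.tail_nonneg[of u] by linarith
  qed (use MT.tail_integrable NT.tail_integrable in auto)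
  then show ?thesis
    using MT.tail_integrable NT.tail_integrable MT.integral_tail NT.integral_tail
      M.mean[OF t] N.mean[OF t] by simp
qed

text \<open>Gronwall by iteration: on a short interval any uniform bound for the distance implies half of
  that bound, and \<open>2 * \<rho>\<close> is a bound to start with. The length of the interval depends on the kernel
  and on \<open>\<rho>\<close> only, so that the argument can be restarted.\<close>
lemma distance_zero_short_time:
  assumes s: "0 \<le> s" and 0: "distance s = 0" and d: "growth_rate * d \<le> 1 / 2"
    and t: "t \<in> {s..s + d}"
  shows "distance t = 0"
proof -
  \<comment> \<open>The length of the interval makes each application of the growth bound gain a factor 1/2.\<close>
  have halving: "distance r \<le> 2 * \<rho> * (1 / 2) ^ n" if "r \<in> {s..s + d}" for n r
    using that
  proof (induction n arbitrary: r)
    case 0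
    then show ?case using distance_le_twice_mean[of r] s by simp
  next
    case (Suc n)
    have V: "0 \<le> 2 * \<rho> * (1 / 2) ^ n" using rho_nonneg by simp
    have "distance r \<le> (r - s) * (growth_rate * (2 * \<rho> * (1 / 2) ^ n))"
      by (rule distance_growth) (use Suc s 0 in auto)
    also have "\<dots> = (growth_rate * (r - s)) * (2 * \<rho> * (1 / 2) ^ n)" by simp
    also have "\<dots> \<le> (1 / 2) * (2 * \<rho> * (1 / 2) ^ n)"
    proof (rule mult_right_mono[OF _ V])
      have "growth_rate * (r - s) \<le> growth_rate * d"
        using growth_rate_nonneg Suc.prems by (intro mult_left_mono) auto
      then show "growth_rate * (r - s) \<le> 1 / 2" using d by simp
    qed
    finally show ?case by simp
  qed
  have "(\<lambda>n. 2 * \<rho> * (1 / 2) ^ n) \<longlonglongrightarrow> 2 * \<rho> * 0"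
    by (intro tendsto_intros) auto
  then have "distance t \<le> 2 * \<rho> * 0"
    by (rule LIMSEQ_le_const) (use halving t in auto)
  then show ?thesis using distance_nonneg[of t] by simp
qed

lemma curves_agree:
  assumes init: "M 0 = N 0" and t: "0 \<le> t"
  shows "M t = N t"
proof -
  \<comment> \<open>Adding 1 keeps the step finite when the growth rate is 0.\<close>
  define d where "d = 1 / (2 * growth_rate + 1)"
  have d: "0 < d" "growth_rate * d \<le> 1 / 2"
    using growth_rate_nonneg by (auto simp: d_def divide_simps)
  have zero: "\<forall>r\<in>{0..real n * d}. distance r = 0" for n
  proof (induction n)
    case 0
    then show ?case using init by (simp add: tail_distance_def)
  next
    case (Suc n)
    show ?case
    proof
      fix r assume r: "r \<in> {0..real (Suc n) * d}"
      show "distance r = 0"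
      proof (cases "r \<le> real n * d")
        case False
        show ?thesis
          by (rule distance_zero_short_time[of "real n * d", OF _ _ d(2)])
             (use Suc d r False in \<open>auto simp: algebra_simps\<close>)
      qed (use Suc r in auto)
    qed
  qed
  obtain n where "t / d < real n" using reals_Archimedean2 by blast
  then have "t \<in> {0..real n * d}" using d t by (simp add: divide_simps)
  with zero have "distance t = 0" by blast
  then show ?thesis by (rule tail_distance_0_imp_eq[OF M.law[OF t] N.law[OF t]])
qed

end

section \<open>Kernels satisfying the regularity assumptions\<close>

text \<open>Restriction to the admissible exchanges. The amount \<open>z = 0\<close> is left out: it changes nothing,
  and \<open>0 < z \<le> x\<close> ensures \<open>x > 0\<close>, where the regularity assumptions apply.\<close>
definition cut :: "(real \<Rightarrow> real \<Rightarrow> real \<Rightarrow> real) \<Rightarrow> real \<Rightarrow> real \<Rightarrow> real \<Rightarrow> real" where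
  "cut F x y z = (if 0 < z \<and> z \<le> x \<and> 0 \<le> y then F x y z else 0)"

lemma kernel_existenceD:
  assumes "kernel_existence K C \<phi>"
  shows "\<forall>z\<ge>0. \<phi> z \<ge> 0"
    "set_integrable lborel {0..} \<phi>" "set_integrable lborel {0..} (\<lambda>z. z * \<phi> z)"
    "\<forall>z\<ge>0. continuous_on quadrant (\<lambda>(x, y). K x y z)"
    "\<forall>x>0. \<forall>y\<ge>0. \<forall>z\<ge>0. 0 \<le> K x y z \<and> K x y z \<le> C * (1 + x) * (1 + y) * \<phi> z"
    "\<exists>\<omega> :: real \<Rightarrow> real. (\<omega> \<longlongrightarrow> 0) (at_right 0) \<and>
      (\<forall>x>0. \<forall>y\<ge>0. \<forall>z\<ge>0. \<forall>z'\<ge>0. \<bar>K x y z - K x y z'\<bar> \<le> \<omega> \<bar>z - z'\<bar>)"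
  by (insert assms[unfolded kernel_existence_def], (elim conjE, assumption)+)

lemma kernel_uniquenessD:
  assumes "kernel_uniqueness K \<phi>"
  shows "0 \<le> z \<Longrightarrow> C1_quadrant (\<lambda>x y. K x y z)"
    "x > 0 \<Longrightarrow> y \<ge> 0 \<Longrightarrow> z \<ge> 0 \<Longrightarrow> \<bar>partial1 (\<lambda>x y. K x y z) x y\<bar> \<le> (1 + y) * \<phi> z"
    "x > 0 \<Longrightarrow> y \<ge> 0 \<Longrightarrow> z \<ge> 0 \<Longrightarrow> \<bar>partial2 (\<lambda>x y. K x y z) x y\<bar> \<le> (1 + x) * \<phi> z"
    "z \<ge> 0 \<Longrightarrow> y \<ge> 0 \<Longrightarrow> K z y z = 0"
  using assms unfolding kernel_uniqueness_def C2_quadrant_def by simp_all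

lemma cut_outside: "\<not> (0 < z \<and> z \<le> x \<and> 0 \<le> y) \<Longrightarrow> cut F x y z = 0"
  unfolding cut_def by (rule if_not_P)

text \<open>Continuity in \<open>(x, y)\<close> for each \<open>z\<close> and a modulus of continuity in \<open>z\<close> common to all
  \<open>(x, y)\<close> together give joint continuity, and with it joint measurability.\<close>
lemma continuous_on_kernel:
  assumes "kernel_existence K C \<phi>"
  shows "continuous_on ({0<..} \<times> {0..} \<times> {0..}) (\<lambda>(x, y, z). K x y z)"
  unfolding continuous_on_iff
proof (intro ballI allI impI)
  fix w :: "real \<times> real \<times> real" and e :: real
  assume w: "w \<in> {0<..} \<times> {0..} \<times> {0..}" and e: "0 < e"
  obtain x0 y0 z0 where w_eq: "w = (x0, y0, z0)" by (cases w)
  have pos: "0 < x0" "0 \<le> y0" "0 \<le> z0" using w w_eq by auto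
  obtain \<omega> :: "real \<Rightarrow> real" where \<omega>: "(\<omega> \<longlongrightarrow> 0) (at_right 0)"
    and mod: "\<And>x y z z'. x > 0 \<Longrightarrow> y \<ge> 0 \<Longrightarrow> z \<ge> 0 \<Longrightarrow> z' \<ge> 0 \<Longrightarrow> \<bar>K x y z - K x y z'\<bar> \<le> \<omega> \<bar>z - z'\<bar>"
    using kernel_existenceD(6)[OF assms] by (elim exE conjE) simp
  have "eventually (\<lambda>h. \<omega> h < e / 2) (at_right 0)"
    using order_tendstoD(2)[OF \<omega>, of "e / 2"] e by simp
  then obtain b where b: "0 < b" "\<And>h. 0 < h \<Longrightarrow> h < b \<Longrightarrow> \<omega> h < e / 2"
    by (auto simp: eventually_at_right_field)
  have cont: "continuous_on quadrant (\<lambda>(x, y). K x y z0)"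
    using kernel_existenceD(4)[OF assms] pos by simp
  have base: "(x0, y0) \<in> quadrant" and e2: "0 < e / 2" using pos e by auto
  obtain d where d: "0 < d"
    "\<And>v. v \<in> quadrant \<Longrightarrow> dist v (x0, y0) < d \<Longrightarrow> dist (case v of (x, y) \<Rightarrow> K x y z0) (K x0 y0 z0) < e / 2"
    using cont[unfolded continuous_on_iff, rule_format, OF base e2] by auto
  show "\<exists>d>0. \<forall>w'\<in>{0<..} \<times> {0..} \<times> {0..}. dist w' w < d \<longrightarrow>
      dist (case w' of (x, y, z) \<Rightarrow> K x y z) (case w of (x, y, z) \<Rightarrow> K x y z) < e"
  proof (intro exI conjI ballI impI)
    show "0 < min b d" using b d by simp
    fix w' assume w': "w' \<in> {0<..} \<times> {0..} \<times> {0..}" and near: "dist w' w < min b d"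
    obtain x y z where w'_eq: "w' = (x, y, z)" by (cases w')
    have pos': "0 < x" "0 \<le> y" "0 \<le> z" using w' w'_eq by auto
    have "dist (x, y) (x0, y0) \<le> dist w' w"
      unfolding w_eq w'_eq dist_Pair_Pair by simp
    then have 1: "\<bar>K x y z0 - K x0 y0 z0\<bar> < e / 2"
      using d(2)[of "(x, y)"] near pos' by (simp add: dist_real_def)
    have "dist z z0 \<le> dist w' w"
      using dist_snd_le[of w' w] dist_snd_le[of "snd w'" "snd w"] by (simp add: w_eq w'_eq)
    then have 2: "\<bar>K x y z - K x y z0\<bar> < e / 2"
      using mod[OF pos'(1,2,3) pos(3)] b(2)[of "\<bar>z - z0\<bar>"] near e
      by (cases "z = z0") (auto simp: dist_real_def)
    show "dist (case w' of (x, y, z) \<Rightarrow> K x y z) (case w of (x, y, z) \<Rightarrow> K x y z) < e"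
      unfolding w_eq w'_eq prod.case dist_real_def using 1 2 by linarith
  qed
qed

lemma kernel_borel:
  assumes "kernel_existence K C \<phi>"
  shows "(\<lambda>(x, y, z). if 0 < x \<and> 0 \<le> y \<and> 0 \<le> z then K x y z else 0)
    \<in> borel_measurable (borel \<Otimes>\<^sub>M borel \<Otimes>\<^sub>M borel)"
proof -
  let ?D = "{0<..} \<times> {0..} \<times> {0..} :: (real \<times> real \<times> real) set"
  have D: "?D \<in> sets borel"
    unfolding borel_prod[symmetric] by (intro pair_measureI) auto
  have "(\<lambda>w. indicator ?D w *\<^sub>R (case w of (x, y, z) \<Rightarrow> K x y z)) \<in> borel_measurable borel"
    by (rule borel_measurable_continuous_on_indicator[OF D continuous_on_kernel[OF assms]])
  also have "(\<lambda>w. indicator ?D w *\<^sub>R (case w of (x, y, z) \<Rightarrow> K x y z))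
      = (\<lambda>(x, y, z). if 0 < x \<and> 0 \<le> y \<and> 0 \<le> z then K x y z else 0)"
    by (auto simp: indicator_def fun_eq_iff)
  finally show ?thesis by (simp only: borel_prod)
qed

lemma has_partial1:
  assumes "C1_quadrant F" "0 < x" "0 \<le> y"
  shows "((\<lambda>u. F u y) has_vector_derivative partial1 F x y) (at x within {0<..})"
  using assms unfolding C1_quadrant_def partial1_def by (simp add: vector_derivative_works[symmetric])

lemma has_partial2:
  assumes "C1_quadrant F" "0 < x" "0 \<le> y"
  shows "((\<lambda>v. F x v) has_vector_derivative partial2 F x y) (at y within {0..})"
  using assms unfolding C1_quadrant_def partial2_def by (simp add: vector_derivative_works[symmetric])

lemma difference_quotient_tendsto:
  fixes g :: "real \<Rightarrow> real"
  assumes d: "(g has_vector_derivative D) (at x within A)" and A: "\<And>h. 0 < h \<Longrightarrow> x + h \<in> A"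
  shows "(\<lambda>n. real (Suc n) * (g (x + inverse (real (Suc n))) - g x)) \<longlonglongrightarrow> D"
proof -
  have "((\<lambda>y. (g y - g x) / (y - x)) \<longlongrightarrow> D) (at x within A)"
    using d by (simp add: has_real_derivative_iff_has_vector_derivative[symmetric] has_field_derivative_iff)
  moreover have "filterlim (\<lambda>n. x + inverse (real (Suc n))) (at x within A) sequentially"
    unfolding filterlim_at
  proof
    show "\<forall>\<^sub>F n in sequentially. x + inverse (real (Suc n)) \<in> A \<and> x + inverse (real (Suc n)) \<noteq> x"
      by (rule always_eventually) (use A in auto)
    show "(\<lambda>n. x + inverse (real (Suc n))) \<longlonglongrightarrow> x"
      using tendsto_add[OF tendsto_const LIMSEQ_inverse_real_of_nat, of x] by simp
  qed
  ultimately have "(\<lambda>n. (g (x + inverse (real (Suc n))) - g x) / (x + inverse (real (Suc n)) - x)) \<longlonglongrightarrow> D"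
    by (rule filterlim_compose)
  then show ?thesis by (simp add: divide_inverse mult.commute)
qed

text \<open>The partial derivatives need not be continuous in \<open>z\<close>; they are jointly measurable as pointwise
  limits of difference quotients of the jointly measurable kernel.\<close>
lemma cut_kernel_measurable:
  assumes ex: "kernel_existence K C \<phi>" and C1: "\<And>z. 0 \<le> z \<Longrightarrow> C1_quadrant (\<lambda>x y. K x y z)"
  shows "(\<lambda>(x, y, z). cut K x y z) \<in> borel_measurable (borel \<Otimes>\<^sub>M borel \<Otimes>\<^sub>M borel)" (is ?t0)
    "(\<lambda>(x, y, z). cut (\<lambda>x y z. partial1 (\<lambda>x y. K x y z) x y) x y z) \<in> borel_measurable (borel \<Otimes>\<^sub>M borel \<Otimes>\<^sub>M borel)" (is ?t1)
    "(\<lambda>(x, y, z). cut (\<lambda>x y z. partial2 (\<lambda>x y. K x y z) x y) x y z) \<in> borel_measurable (borel \<Otimes>\<^sub>M borel \<Otimes>\<^sub>M borel)" (is ?t2)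
proof -
  define K0 where "K0 x y z = (if 0 < x \<and> 0 \<le> y \<and> 0 \<le> z then K x y z else 0)" for x y z
  have K0: "(\<lambda>(x, y, z). K0 x y z) \<in> borel_measurable (borel \<Otimes>\<^sub>M borel \<Otimes>\<^sub>M borel)"
    unfolding K0_def by (rule kernel_borel[OF ex])
  have [measurable]: "(\<lambda>w. K0 (g w) (h w) (i w)) \<in> borel_measurable L"
    if [measurable]: "g \<in> borel_measurable L" "h \<in> borel_measurable L" "i \<in> borel_measurable L"
    for g h i and L :: "(real \<times> real \<times> real) measure"
  proof -
    have "(\<lambda>w. (g w, h w, i w)) \<in> L \<rightarrow>\<^sub>M borel \<Otimes>\<^sub>M borel \<Otimes>\<^sub>M borel" by measurable
    from measurable_compose[OF this K0] show ?thesis by simp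
  qed
  have "(\<lambda>(x, y, z). if 0 < z \<and> z \<le> x \<and> 0 \<le> y then K0 x y z else 0)
      \<in> borel_measurable (borel \<Otimes>\<^sub>M borel \<Otimes>\<^sub>M borel)" by measurable
  also have "(\<lambda>(x, y, z). if 0 < z \<and> z \<le> x \<and> 0 \<le> y then K0 x y z else 0) = (\<lambda>(x, y, z). cut K x y z)"
    by (auto simp: K0_def cut_def)
  finally show ?t0 .
  show ?t1
  proof (rule borel_measurable_LIMSEQ_real)
    define q where "q n x y z = (if 0 < z \<and> z \<le> x \<and> 0 \<le> y
      then real (Suc n) * (K0 (x + inverse (real (Suc n))) y z - K0 x y z) else 0)" for n x y z
    show "(\<lambda>(x, y, z). q n x y z) \<in> borel_measurable (borel \<Otimes>\<^sub>M borel \<Otimes>\<^sub>M borel)" for n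
      unfolding q_def by measurable
    have "(\<lambda>n. q n x y z) \<longlonglongrightarrow> cut (\<lambda>x y z. partial1 (\<lambda>x y. K x y z) x y) x y z" for x y z
    proof (cases "0 < z \<and> z \<le> x \<and> 0 \<le> y")
      case True
      have "(\<lambda>n. real (Suc n) * (K (x + inverse (real (Suc n))) y z - K x y z)) \<longlonglongrightarrow> partial1 (\<lambda>x y. K x y z) x y"
        by (rule difference_quotient_tendsto[OF has_partial1[OF C1]]) (use True in auto)
      moreover have "q n x y z = real (Suc n) * (K (x + inverse (real (Suc n))) y z - K x y z)" for n
        using True by (simp add: q_def K0_def add_pos_pos)
      ultimately show ?thesis using True by (simp add: cut_def)
    qed (auto simp: q_def cut_def)
    then show "(\<lambda>n. case w of (x, y, z) \<Rightarrow> q n x y z) \<longlonglongrightarrow>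
        (case w of (x, y, z) \<Rightarrow> cut (\<lambda>x y z. partial1 (\<lambda>x y. K x y z) x y) x y z)" for w
      by (cases w) simp
  qed
  show ?t2
  proof (rule borel_measurable_LIMSEQ_real)
    define q where "q n x y z = (if 0 < z \<and> z \<le> x \<and> 0 \<le> y
      then real (Suc n) * (K0 x (y + inverse (real (Suc n))) z - K0 x y z) else 0)" for n x y z
    show "(\<lambda>(x, y, z). q n x y z) \<in> borel_measurable (borel \<Otimes>\<^sub>M borel \<Otimes>\<^sub>M borel)" for n
      unfolding q_def by measurable
    have "(\<lambda>n. q n x y z) \<longlonglongrightarrow> cut (\<lambda>x y z. partial2 (\<lambda>x y. K x y z) x y) x y z" for x y z
    proof (cases "0 < z \<and> z \<le> x \<and> 0 \<le> y")
      case True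
      have "(\<lambda>n. real (Suc n) * (K x (y + inverse (real (Suc n))) z - K x y z)) \<longlonglongrightarrow> partial2 (\<lambda>x y. K x y z) x y"
        by (rule difference_quotient_tendsto[OF has_partial2[OF C1]]) (use True in auto)
      moreover have "q n x y z = real (Suc n) * (K x (y + inverse (real (Suc n))) z - K x y z)" for n
        using True by (simp add: q_def K0_def)
      ultimately show ?thesis using True by (simp add: cut_def)
    qed (auto simp: q_def cut_def)
    then show "(\<lambda>n. case w of (x, y, z) \<Rightarrow> q n x y z) \<longlonglongrightarrow>
        (case w of (x, y, z) \<Rightarrow> cut (\<lambda>x y z. partial2 (\<lambda>x y. K x y z) x y) x y z)" for w
      by (cases w) simp
  qed
qed

lemma partial1_FTC:
  assumes C1: "C1_quadrant F" and "0 < a" "a \<le> b" "0 \<le> y"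
  shows "F b y - F a y = (LINT u:{a..b}|lborel. partial1 F u y)"
proof -
  have "((\<lambda>u. F u y) has_vector_derivative partial1 F u y) (at u within {a..b})" if "a \<le> u" "u \<le> b" for u
    by (rule has_vector_derivative_within_subset[OF has_partial1[OF C1]]) (use assms that in auto)
  moreover have "continuous_on {a..b} (\<lambda>u. partial1 F u y)"
  proof -
    have "continuous_on {a..b} (\<lambda>u. (\<lambda>(x, y). partial1 F x y) (u, y))"
      by (rule continuous_on_compose2[of quadrant])
         (use assms in \<open>auto simp: C1_quadrant_def intro!: continuous_intros\<close>)
    then show ?thesis by simp
  qed
  ultimately show ?thesis
    using has_bochner_integral_FTC_Icc[OF assms(3), of "\<lambda>u. F u y" "\<lambda>u. partial1 F u y"]
    by (auto simp: set_lebesgue_integral_def has_bochner_integral_iff)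
qed

lemma partial2_FTC:
  assumes C1: "C1_quadrant F" and "0 < x" "0 \<le> a" "a \<le> b"
  shows "F x b - F x a = (LINT v:{a..b}|lborel. partial2 F x v)"
proof -
  have "((\<lambda>v. F x v) has_vector_derivative partial2 F x v) (at v within {a..b})" if "a \<le> v" "v \<le> b" for v
    by (rule has_vector_derivative_within_subset[OF has_partial2[OF C1]]) (use assms that in auto)
  moreover have "continuous_on {a..b} (\<lambda>v. partial2 F x v)"
  proof -
    have "continuous_on {a..b} (\<lambda>v. (\<lambda>(x, y). partial2 F x y) (x, v))"
      by (rule continuous_on_compose2[of quadrant])
         (use assms in \<open>auto simp: C1_quadrant_def intro!: continuous_intros\<close>)
    then show ?thesis by simp
  qed
  ultimately show ?thesis
    using has_bochner_integral_FTC_Icc[OF assms(4), of "\<lambda>v. F x v" "\<lambda>v. partial2 F x v"]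
    by (auto simp: set_lebesgue_integral_def has_bochner_integral_iff)
qed

lemma exchange_kernel_cut:
  assumes ex: "kernel_existence K C \<phi>" and un: "kernel_uniqueness K \<phi>"
  shows "exchange_kernel (cut K) (cut (\<lambda>x y z. partial1 (\<lambda>x y. K x y z) x y))
    (cut (\<lambda>x y z. partial2 (\<lambda>x y. K x y z) x y)) (\<lambda>z. indicator {0..} z * \<phi> z) \<bar>C\<bar>"
proof -
  have C1: "C1_quadrant (\<lambda>x y. K x y z)" if "0 \<le> z" for z
    using kernel_uniquenessD(1)[OF un that] .
  have phi: "0 \<le> z \<Longrightarrow> 0 \<le> \<phi> z" for z using kernel_existenceD(1)[OF ex] by simp
  have K_bd: "0 \<le> K x y z" "K x y z \<le> C * (1 + x) * (1 + y) * \<phi> z" if "0 < x" "0 \<le> y" "0 \<le> z" for x y z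
    using kernel_existenceD(5)[OF ex] that by simp_all
  have P_bd: "\<bar>partial1 (\<lambda>x y. K x y z) x y\<bar> \<le> (1 + y) * \<phi> z" "\<bar>partial2 (\<lambda>x y. K x y z) x y\<bar> \<le> (1 + x) * \<phi> z"
    if "0 < x" "0 \<le> y" "0 \<le> z" for x y z
    using kernel_uniquenessD(2,3)[OF un that] .
  have bdry: "K z y z = 0" if "0 \<le> z" "0 \<le> y" for y z
    using kernel_uniquenessD(4)[OF un that] .
  show ?thesis
  proof
    show "integrable lborel (\<lambda>z. indicator {0..} z * \<phi> z)"
      using kernel_existenceD(2)[OF ex] by (simp add: set_integrable_def)
    have "integrable lborel (\<lambda>z. indicator {0..} z *\<^sub>R (z * \<phi> z))"
      using kernel_existenceD(3)[OF ex] by (simp add: set_integrable_def)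
    then show "integrable lborel (\<lambda>z. z * (indicator {0..} z * \<phi> z))"
      by (simp add: mult_ac)
    show "0 \<le> indicator {0..} z * \<phi> z" for z using phi[of z] by (auto simp: indicator_def)
    show "0 \<le> cut K x y z" for x y z using K_bd(1)[of x y z] by (auto simp: cut_def)
    show "cut K x y z \<le> \<bar>C\<bar> * (1 + x) * (1 + y) * (indicator {0..} z * \<phi> z)" if "0 \<le> x" "0 \<le> y" for x y z
    proof (cases "0 < z \<and> z \<le> x")
      case True
      have "C * (1 + x) * (1 + y) * \<phi> z \<le> \<bar>C\<bar> * (1 + x) * (1 + y) * \<phi> z"
        using that phi[of z] True by (intro mult_right_mono) auto
      then have "K x y z \<le> \<bar>C\<bar> * (1 + x) * (1 + y) * \<phi> z"
        using K_bd(2)[of x y z] True that by linarith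
      then show ?thesis using True that by (simp add: cut_def)
    next
      case False
      then show ?thesis using that phi[of z] by (auto simp: cut_def indicator_def)
    qed
    show "\<bar>cut (\<lambda>x y z. partial1 (\<lambda>x y. K x y z) x y) x y z\<bar> \<le> (1 + y) * (indicator {0..} z * \<phi> z)"
      if "0 \<le> x" "0 \<le> y" for x y z
      using P_bd(1)[of x y z] that phi[of z] by (auto simp: cut_def indicator_def)
    show "\<bar>cut (\<lambda>x y z. partial2 (\<lambda>x y. K x y z) x y) x y z\<bar> \<le> (1 + x) * (indicator {0..} z * \<phi> z)"
      if "0 \<le> x" "0 \<le> y" for x y z
      using P_bd(2)[of x y z] that phi[of z] by (auto simp: cut_def indicator_def)
    show "cut K x y z = (LINT u:{z..x}|lborel. cut (\<lambda>x y z. partial1 (\<lambda>x y. K x y z) x y) u y z)"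
      if "0 < z" "z \<le> x" "0 \<le> y" for x y z
    proof -
      have "cut K x y z = (LINT u:{z..x}|lborel. partial1 (\<lambda>x y. K x y z) u y)"
        using partial1_FTC[OF C1, of z z x y] bdry[of z y] that by (simp add: cut_def)
      also have "\<dots> = (LINT u:{z..x}|lborel. cut (\<lambda>x y z. partial1 (\<lambda>x y. K x y z) x y) u y z)"
        unfolding set_lebesgue_integral_def
        by (rule Bochner_Integration.integral_cong) (use that in \<open>auto simp: cut_def split: split_indicator\<close>)
      finally show ?thesis .
    qed
    show "cut K x y z = cut K x 0 z + (LINT v:{0..y}|lborel. cut (\<lambda>x y z. partial2 (\<lambda>x y. K x y z) x y) x v z)"
      if "0 < z" "z \<le> x" "0 \<le> y" for x y z
    proof -
      have "cut K x y z = cut K x 0 z + (LINT v:{0..y}|lborel. partial2 (\<lambda>x y. K x y z) x v)"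
        using partial2_FTC[OF C1, of z x 0 y] that by (simp add: cut_def)
      also have "(LINT v:{0..y}|lborel. partial2 (\<lambda>x y. K x y z) x v)
          = (LINT v:{0..y}|lborel. cut (\<lambda>x y z. partial2 (\<lambda>x y. K x y z) x y) x v z)"
        unfolding set_lebesgue_integral_def
        by (rule Bochner_Integration.integral_cong) (use that in \<open>auto simp: cut_def split: split_indicator\<close>)
      finally show ?thesis .
    qed
  qed ((rule cut_kernel_measurable[OF ex C1] cut_outside; assumption) | simp)+
qed

section \<open>Weak solutions and uniqueness\<close>

text \<open>Pushing the laws from the half-line to the whole line makes all measurability conditions refer
  to the same Borel sets as for Lebesgue measure.\<close>
definition borel_law :: "real measure \<Rightarrow> real measure" where
  "borel_law P = distr P borel (\<lambda>x. x)"

lemma prob_Rplus_measurable: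
  assumes "P \<in> prob_Rplus" "g \<in> borel_measurable borel"
  shows "g \<in> borel_measurable P"
proof -
  have "sets P = sets (restrict_space borel {0..})" using assms(1) by (simp add: prob_Rplus_def)
  then show ?thesis
    using measurable_restrict_space1[OF assms(2)] by (simp cong: measurable_cong_sets)
qed

lemma space_prob_Rplus: "P \<in> prob_Rplus \<Longrightarrow> space P = {0..}"
  by (auto simp: prob_Rplus_def space_restrict_space dest: sets_eq_imp_space_eq)

lemma prob_Rplus_id_measurable: "P \<in> prob_Rplus \<Longrightarrow> (\<lambda>x. x) \<in> P \<rightarrow>\<^sub>M borel"
  by (rule prob_Rplus_measurable) simp_all

lemma integral_borel_law:
  fixes g :: "real \<Rightarrow> real"
  assumes "P \<in> prob_Rplus" "g \<in> borel_measurable borel"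
  shows "(\<integral>x. g x \<partial>borel_law P) = (\<integral>x. g x \<partial>P)"
  unfolding borel_law_def by (rule integral_distr[OF prob_Rplus_id_measurable[OF assms(1)] assms(2)])

lemma halfline_law_borel_law:
  assumes P: "P \<in> prob_Rplus" and int: "integrable P (\<lambda>x. x)"
  shows "halfline_law (borel_law P)"
proof -
  note id = prob_Rplus_id_measurable[OF P]
  have "prob_space P" using P by (simp add: prob_Rplus_def)
  then interpret Q: prob_space "borel_law P"
    unfolding borel_law_def by (rule prob_space.prob_space_distr[OF _ id])
  show ?thesis
  proof
    show "sets (borel_law P) = sets borel" by (simp add: borel_law_def)
    have "AE x in P. 0 \<le> x" by (rule AE_I2) (simp add: space_prob_Rplus[OF P])
    moreover have "{x \<in> space borel. 0 \<le> (x::real)} \<in> sets borel" by simp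
    ultimately show "AE x in borel_law P. 0 \<le> x"
      unfolding borel_law_def by (simp only: AE_distr_iff[OF id])
    have "(\<lambda>x. x) \<in> borel_measurable (borel :: real measure)" by simp
    from integrable_distr_eq[OF id this] int show "integrable (borel_law P) (\<lambda>x. x)"
      unfolding borel_law_def by blast
  qed
qed

lemma borel_law_inject:
  assumes P: "P \<in> prob_Rplus" and Q: "Q \<in> prob_Rplus" and eq: "borel_law P = borel_law Q"
  shows "P = Q"
proof (rule measure_eqI)
  have sets: "sets P = sets (restrict_space borel {0..})" "sets Q = sets (restrict_space borel {0..})"
    using P Q by (simp_all add: prob_Rplus_def)
  then show "sets P = sets Q" by simp
  fix A assume "A \<in> sets P"
  then have A: "A \<in> sets borel" "A \<subseteq> {0..}"
    using sets(1) by (auto simp: sets_restrict_space_iff)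
  have "emeasure (borel_law R) A = emeasure R A" if R: "R \<in> prob_Rplus" for R
  proof -
    have "(\<lambda>x. x) -` A \<inter> space R = A" using A(2) space_prob_Rplus[OF R] by auto
    then show ?thesis
      unfolding borel_law_def by (subst emeasure_distr[OF prob_Rplus_id_measurable[OF R] A(1)]) simp
  qed
  from this[OF P] this[OF Q] show "emeasure P A = emeasure Q A" using eq by simp
qed

text \<open>At \<open>z = 0\<close> the kernel \<open>K\<close> and its restriction may differ, but there \<open>exchange f x y z\<close> is 0.\<close>
lemma (in tested_kernel) Q_op_borel_law:
  assumes k: "k = cut K" and P: "P \<in> prob_Rplus" and int: "integrable P (\<lambda>x. x)"
  shows "Q_op K P f = Q_rate (borel_law P) f"
proof -
  interpret L: halfline_law "borel_law P" by (rule halfline_law_borel_law[OF P int])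
  have inner: "(LINT z:{0..x}|lborel. K x y z * exchange f x y z) = pair_rate f x y" if "0 \<le> y" for x y
    unfolding pair_rate_def set_lebesgue_integral_def unfolding k
    by (rule Bochner_Integration.integral_cong)
       (use that in \<open>auto simp: cut_def exchange_def split: split_indicator\<close>)
  have y_int: "(LINT y|P. (LINT z:{0..x}|lborel. K x y z * exchange f x y z)) = (\<integral>y. pair_rate f x y \<partial>borel_law P)" for x
  proof -
    have "(LINT y|P. (LINT z:{0..x}|lborel. K x y z * exchange f x y z)) = (\<integral>y. pair_rate f x y \<partial>P)"
      by (rule Bochner_Integration.integral_cong) (simp_all add: inner space_prob_Rplus[OF P])
    then show ?thesis by (simp add: integral_borel_law[OF P])
  qed
  have m: "(\<lambda>x. \<integral>y. pair_rate f x y \<partial>borel_law P) \<in> borel_measurable borel"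
    by (rule L.borel_measurable_lebesgue_integral) measurable
  show ?thesis
    unfolding Q_op_def Q_rate_def y_int using integral_borel_law[OF P m] by simp
qed

lemma lipschitz_Rplus_id: "lipschitz_Rplus (\<lambda>x. x)"
  unfolding lipschitz_Rplus_def by (rule exI[of _ 1], rule lipschitz_onI) auto

lemma weak_solutionD:
  assumes "weak_solution K c"
  shows "0 \<le> t \<Longrightarrow> c t \<in> prob_Rplus"
    and "lipschitz_Rplus f \<Longrightarrow> 0 \<le> t \<Longrightarrow> integrable (c t) f"
    and "lipschitz_Rplus f \<Longrightarrow> 0 \<le> s \<Longrightarrow> s \<le> t \<Longrightarrow> set_integrable lborel {s..t} (\<lambda>r. Q_op K (c r) f)"
    and "lipschitz_Rplus f \<Longrightarrow> 0 \<le> s \<Longrightarrow> s \<le> t \<Longrightarrow>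
      (LINT x|c t. f x) - (LINT x|c s. f x) = (LINT r:{s..t}|lborel. Q_op K (c r) f)"
  using assms by (simp_all add: weak_solution_def)

text \<open>An exchange preserves the total size, so \<open>f x = x\<close> is a conserved quantity.\<close>
lemma weak_solution_mean:
  assumes sol: "weak_solution K c" and t: "0 \<le> t"
  shows "integrable (c t) (\<lambda>x. x)" "(\<integral>x. x \<partial>c t) = (\<integral>x. x \<partial>c 0)"
proof -
  have "(LINT x|c t. x) - (LINT x|c 0. x) = (LINT r:{0..t}|lborel. Q_op K (c r) (\<lambda>x. x))"
    by (rule weak_solutionD(4)[OF sol lipschitz_Rplus_id _ t]) simp
  moreover have "Q_op K (c r) (\<lambda>x. x) = 0" for r
    by (simp add: Q_op_def exchange_def set_lebesgue_integral_def)
  ultimately show "(\<integral>x. x \<partial>c t) = (\<integral>x. x \<partial>c 0)" by simp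
  show "integrable (c t) (\<lambda>x. x)" by (rule weak_solutionD(2)[OF sol lipschitz_Rplus_id t])
qed

lemma exchange_curve_borel_law:
  assumes ker: "exchange_kernel (cut K) k1 k2 \<phi> C" and sol: "weak_solution K c"
    and \<rho>: "(\<integral>x. x \<partial>c 0) = \<rho>"
  shows "exchange_curve (cut K) k1 k2 \<phi> C (\<lambda>t. borel_law (c t)) \<rho>"
proof -
  interpret exchange_kernel "cut K" k1 k2 \<phi> C by fact
  note P = weak_solutionD(1)[OF sol] and evol = weak_solutionD(3,4)[OF sol]
  have Q: "Q_op K (c r) (antideriv p) = Q_rate (borel_law (c r)) (antideriv p)"
    if "test_slope p" "0 \<le> r" for p r
  proof -
    interpret test_slope p by fact
    interpret tested_kernel "cut K" k1 k2 \<phi> C p ..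
    show ?thesis
      by (rule Q_op_borel_law[OF refl P[OF that(2)] weak_solution_mean(1)[OF sol that(2)]])
  qed
  show ?thesis
  proof (intro exchange_curve.intro exchange_curve_axioms.intro exchange_kernel_axioms)
    fix t :: real assume t: "0 \<le> t"
    show "halfline_law (borel_law (c t))"
      by (rule halfline_law_borel_law[OF P[OF t] weak_solution_mean(1)[OF sol t]])
    show "(\<integral>x. x \<partial>borel_law (c t)) = \<rho>"
      using integral_borel_law[OF P[OF t], of "\<lambda>x. x"] weak_solution_mean(2)[OF sol t] \<rho> by simp
  next
    fix p and s t :: real assume p: "test_slope p" and st: "0 \<le> s" "s \<le> t"
    interpret test_slope p by (rule p)
    have eq: "r \<in> {s..t} \<Longrightarrow> Q_op K (c r) (antideriv p) = Q_rate (borel_law (c r)) (antideriv p)" for r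
      using Q[OF p] st by simp
    show "set_integrable lborel {s..t} (\<lambda>r. Q_rate (borel_law (c r)) (antideriv p))"
      by (rule iffD1[OF set_integrable_cong[OF refl refl eq] evol(1)[OF lipschitz_antideriv st]])
    have "(LINT r:{s..t}|lborel. Q_op K (c r) (antideriv p))
        = (LINT r:{s..t}|lborel. Q_rate (borel_law (c r)) (antideriv p))"
      by (rule set_lebesgue_integral_cong) (use eq in auto)
    then show "(\<integral>x. antideriv p x \<partial>borel_law (c t)) - (\<integral>x. antideriv p x \<partial>borel_law (c s))
        = (LINT r:{s..t}|lborel. Q_rate (borel_law (c r)) (antideriv p))"
      using evol(2)[OF lipschitz_antideriv st] st P by (simp add: integral_borel_law)
  qed
qed

theorem theorem1p11:
  fixes K :: "real \<Rightarrow> real \<Rightarrow> real \<Rightarrow> real"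
    and C\<^sub>K :: real and \<phi> :: "real \<Rightarrow> real" and \<rho> :: real
    and c\<^sub>0 :: "real measure" and c d :: "real \<Rightarrow> real measure"
  assumes "kernel_existence K C\<^sub>K \<phi>"
    and "kernel_uniqueness K \<phi>"
    and "\<rho> \<ge> 0"
    and "c\<^sub>0 \<in> prob_Rplus_moment \<rho>"
    and "weak_solution K c" and "c 0 = c\<^sub>0"
    and "weak_solution K d" and "d 0 = c\<^sub>0"
    and "AE t in lborel. t \<ge> 0 \<longrightarrow> has_lebesgue_density (c t)"
    and "AE t in lborel. t \<ge> 0 \<longrightarrow> has_lebesgue_density (d t)"
  shows "\<forall>t\<ge>0. c t = d t"
proof (intro allI impI)
  fix t :: real assume t: "0 \<le> t"
  note kernel = exchange_kernel_cut[OF assms(1,2)]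
  have mean: "(\<integral>x. x \<partial>c 0) = \<rho>" "(\<integral>x. x \<partial>d 0) = \<rho>"
    using assms(4,6,8) by (simp_all add: prob_Rplus_moment_def)
  have pair: "exchange_curve_pair (cut K) (cut (\<lambda>x y z. partial1 (\<lambda>x y. K x y z) x y))
      (cut (\<lambda>x y z. partial2 (\<lambda>x y. K x y z) x y)) (\<lambda>z. indicator {0..} z * \<phi> z) \<bar>C\<^sub>K\<bar>
      (\<lambda>t. borel_law (c t)) (\<lambda>t. borel_law (d t)) \<rho>"
    by (intro exchange_curve_pair.intro exchange_curve_borel_law[OF kernel] assms mean)
  have "borel_law (c t) = borel_law (d t)"
    by (rule exchange_curve_pair.curves_agree[OF pair _ t]) (simp add: assms)
  moreover have "c t \<in> prob_Rplus" "d t \<in> prob_Rplus"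
    using weak_solutionD(1)[OF assms(5) t] weak_solutionD(1)[OF assms(7) t] by simp_all
  ultimately show "c t = d t" by (rule borel_law_inject[rotated 2])
qed

end
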